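(* Let $\Omega\subsetneq\mathcal{X}$ be a Kobayashi hyperbolic domain of a complex manifold $\mathcal{X}$, with $\overline\Omega^{\mathrm{End}}$ sequentially compact. Given $p\in\Omega$, $R>0$ and $x\in\partial\overline\Omega^{\mathrm{End}}$, we have $$H^b_p(x,R)=\bigcup_{\xi\in\mathscr{H}(x)}H_p(\xi,R)\quad\text{and}\quad H^s_p(x,R)=\bigcap_{\xi\in\mathscr{H}(x)}H_p(\xi,R),$$ where $H^b_p(x,R)$ and $H^s_p(x,R)$ are the big and small horospheres with center $x$, pole $p$ and radius $R$, and $H_p(\xi,R)$ is the horoball with center $\xi$, pole $p$ and radius $R$.
   Context: $\mathsf{k}_\Omega$ is the Kobayashi distance of $\Omega$; $\Omega$ is Kobayashi hyperbolic if $\mathsf{k}_\Omega$ is a genuine distance. A domain is a nonempty connected open set; $\overline\Omega$ is the closure of $\Omega$ in $\mathcal{X}$. Limits $w\to x$ are taken with $w\in\Omega$, in the topology of $\overline\Omega^{\mathrm{End}}$. End compactification: let $(K_j)_{j\ge1}$ be an exhaustion of $\overline\Omega$ by compact sets with $K_j\subset\mathrm{int}(K_{j+1})$. An end is a sequence $(F_j)_{j\ge1}$ where $F_j$ is a connected component of $\overline\Omega\setminus K_j$ and $F_{j+1}\subset F_j$. With $\mathcal{E}$ the set of ends, $\overline\Omega^{\mathrm{End}}=\overline\Omega\sqcup\mathcal{E}$. A neighbourhood basis at $x\in\overline\Omega$ is given by the sets $U\cap\overline\Omega$, $U$ a neighbourhood of $x$ in $\mathcal{X}$; at an end $e=(F_j)$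 it is given by $\widehat F_j=F_j\sqcup\{(G_\nu)\in\mathcal{E}: G_\nu=F_\nu,\ \nu=1,\dots,j\}$, $j\ge1$. This is a first-countable Hausdorff topology independent of the exhaustion. $\partial\overline\Omega^{\mathrm{End}}=\overline\Omega^{\mathrm{End}}\setminus\Omega$. Metric compactification of $(\Omega,\mathsf{k}_\Omega)$: let $C(\Omega)$ be the real-valued continuous functions on $\Omega$ with the topology of local uniform convergence, $C_*(\Omega)$ its quotient by the constant functions with the quotient topology, and $i_{\mathsf{k}}:\Omega\to C_*(\Omega)$, $i_{\mathsf{k}}(x)=[\mathsf{k}_\Omega(x,\cdot)]$. Then $\overline\Omega^{\mathsf{k}}$ is the closure of $i_{\mathsf{k}}(\Omega)$ in $C_*(\Omega)$ and $\partial\overline\Omega^{\mathsf{k}}=\overline\Omega^{\mathsf{k}}\setminus i_{\mathsf{k}}(\Omega)$. For $\xi\in\partial\overline\Omega^{\mathsf{k}}$, $h_{p,\xi}$ is the unique function in the class $\xi$ with $h_{p,\xi}(p)=0$, and for $R>0$, $H_p(\xi,R)=\{z\in\Omega: h_{p,\xi}(z)<\frac12\log R\}$. For $x\in\partial\overline\Omega^{\mathrm{End}}$: $\mathscr{H}(x)=\{\xi\in\overline\Omega^{\mathsf{k}}\setminus i_{\mathsf{k}}(\Omega): \exists (x_n)\subset\Omega \text{ with } x_n\to x \text{ in } \overline\Omega^{\mathrm{End}} \text{ and } i_{\mathsf{k}}(x_n)\to\xi\}$, and for $R>0$, $H^b_p(x,R)=\{z\in\Omega:\liminf_{w\to x}(\mathsf{k}_\Omega(z,w)-\mathsf{k}_\Omega(p,w))<\frac12\log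 R\}$, $H^s_p(x,R)=\{z\in\Omega:\limsup_{w\to x}(\mathsf{k}_\Omega(z,w)-\mathsf{k}_\Omega(p,w))<\frac12\log R\}$. *)

theory Defs
  imports "HOL-Analysis.Analysis"
begin

section \<open>Complex manifolds and holomorphic discs\<close>

text \<open>Holomorphy of maps between open subsets of complex coordinate spaces: Frechet
  differentiability with complex linear derivative.\<close>

definition holomorphic_vec_on :: "(complex^'n \<Rightarrow> complex^'m) \<Rightarrow> (complex^'n) set \<Rightarrow> bool" where
  "holomorphic_vec_on f S \<longleftrightarrow>
     (\<forall>z\<in>S. \<exists>D. (f has_derivative D) (at z) \<and> (\<forall>c v. D (c *s v) = c *s D v))"

type_synonym ('a, 'n) chart = "'a set \<times> ('a \<Rightarrow> complex^'n)"

text \<open>The manifold is the whole type \<open>'a\<close>, Hausdorff and second countable by its sort; the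
  complex structure is given by a holomorphic atlas, not required to be maximal.  Of a chart
  \<open>(U, \<phi>)\<close> only the restriction of \<open>\<phi>\<close> to \<open>U\<close> matters.\<close>

definition complex_manifold ::
  "('a::{t2_space, second_countable_topology}, 'n::finite) chart set \<Rightarrow> bool" where
  "complex_manifold A \<longleftrightarrow>
     (\<forall>(U, \<phi>)\<in>A. open U \<and> open (\<phi> ` U) \<and> homeomorphism U (\<phi> ` U) \<phi> (inv_into U \<phi>)) \<and>
     (\<Union>(U, \<phi>)\<in>A. U) = UNIV \<and>
     (\<forall>(U, \<phi>)\<in>A. \<forall>(V, \<psi>)\<in>A. holomorphic_vec_on (\<psi> \<circ> inv_into U \<phi>) (\<phi> ` (U \<inter> V)))"

definition is_domain :: "'a::topological_space set \<Rightarrow> bool" where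
  "is_domain \<Omega> \<longleftrightarrow> open \<Omega> \<and> connected \<Omega> \<and> \<Omega> \<noteq> {}"

definition holomorphic_disc ::
  "('a::topological_space, 'n::finite) chart set \<Rightarrow> 'a set \<Rightarrow> (complex \<Rightarrow> 'a) \<Rightarrow> bool" where
  "holomorphic_disc A \<Omega> f \<longleftrightarrow>
     f ` ball 0 1 \<subseteq> \<Omega> \<and> continuous_on (ball 0 1) f \<and>
     (\<forall>(U, \<phi>)\<in>A. \<forall>i. (\<lambda>z. \<phi> (f z) $ i) holomorphic_on {z \<in> ball 0 1. f z \<in> U})"


section \<open>The Kobayashi distance\<close>

text \<open>The normalisation is the one matching radii \<open>1/2 log R\<close> of horospheres (curvature -4).\<close>

definition poincare_dist :: "complex \<Rightarrow> complex \<Rightarrow> real" where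
  "poincare_dist z w = artanh (cmod ((z - w) / (1 - cnj w * z)))"

text \<open>Infimum of the Poincare lengths of the chains of holomorphic discs in \<open>\<Omega>\<close> joining
  \<open>z\<close> to \<open>w\<close>; \<open>\<zeta>\<close> lists the junction points.  For \<open>\<Omega>\<close> a domain and \<open>z, w \<in> \<Omega>\<close> such
  chains exist, so the infimum is that of a nonempty set of nonnegative reals.  The value \<open>0\<close>
  outside \<open>\<Omega>\<close> is a convention (the locale \<open>Metric_space\<close> used below demands
  nonnegativity and symmetry of the total function).\<close>

definition kobayashi ::
  "('a::topological_space, 'n::finite) chart set \<Rightarrow> 'a set \<Rightarrow> 'a \<Rightarrow> 'a \<Rightarrow> real" where
  "kobayashi A \<Omega> z w =
     (if z \<in> \<Omega> \<and> w \<in> \<Omega>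
      then Inf {(\<Sum>j<m. poincare_dist (a j) (b j)) | (m::nat) f a b \<zeta>.
             \<zeta> 0 = z \<and> \<zeta> m = w \<and>
             (\<forall>j<m. holomorphic_disc A \<Omega> (f j) \<and> a j \<in> ball 0 1 \<and> b j \<in> ball 0 1 \<and>
                    f j (a j) = \<zeta> j \<and> f j (b j) = \<zeta> (Suc j))}
      else 0)"

definition kobayashi_hyperbolic ::
  "('a::topological_space, 'n::finite) chart set \<Rightarrow> 'a set \<Rightarrow> bool" where
  "kobayashi_hyperbolic A \<Omega> \<longleftrightarrow> Metric_space \<Omega> (kobayashi A \<Omega>)"


section \<open>The end compactification\<close>

definition compact_exhaustion :: "'a::topological_space set \<Rightarrow> (nat \<Rightarrow> 'a set) \<Rightarrow> bool" where
  "compact_exhaustion S K \<longleftrightarrow>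
     (\<forall>j. compact (K j)) \<and> (\<Union>j. K j) = S \<and>
     (\<forall>j. K j \<subseteq> (top_of_set S) interior_of (K (Suc j)))"

definition ends :: "'a::topological_space set \<Rightarrow> (nat \<Rightarrow> 'a set) \<Rightarrow> (nat \<Rightarrow> 'a set) set" where
  "ends \<Omega> K = {F. \<forall>j. F j \<in> components (closure \<Omega> - K j) \<and> F (Suc j) \<subseteq> F j}"

text \<open>Points of the closure are tagged with \<open>Inl\<close>, ends with \<open>Inr\<close>.\<close>

type_synonym 'a end_point = "'a + (nat \<Rightarrow> 'a set)"

definition end_closure ::
  "'a::topological_space set \<Rightarrow> (nat \<Rightarrow> 'a set) \<Rightarrow> 'a end_point set" where
  "end_closure \<Omega> K = Inl ` closure \<Omega> \<union> Inr ` ends \<Omega> K"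

definition end_hat ::
  "'a::topological_space set \<Rightarrow> (nat \<Rightarrow> 'a set) \<Rightarrow> (nat \<Rightarrow> 'a set) \<Rightarrow> nat \<Rightarrow> 'a end_point set" where
  "end_hat \<Omega> K F j = Inl ` F j \<union> Inr ` {G \<in> ends \<Omega> K. \<forall>\<nu>\<le>j. G \<nu> = F \<nu>}"

fun end_nbhd_base ::
  "'a::topological_space set \<Rightarrow> (nat \<Rightarrow> 'a set) \<Rightarrow> 'a end_point \<Rightarrow> 'a end_point set set" where
  "end_nbhd_base \<Omega> K (Inl y) = {Inl ` (U \<inter> closure \<Omega>) | U. open U \<and> y \<in> U}"
| "end_nbhd_base \<Omega> K (Inr F) = range (end_hat \<Omega> K F)"

definition end_topology ::
  "'a::topological_space set \<Rightarrow> (nat \<Rightarrow> 'a set) \<Rightarrow> 'a end_point topology" where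
  "end_topology \<Omega> K =
     topology (\<lambda>V. V \<subseteq> end_closure \<Omega> K \<and> (\<forall>x\<in>V. \<exists>B\<in>end_nbhd_base \<Omega> K x. B \<subseteq> V))"

lemma end_nbhd_base_directed:
  assumes "x \<in> end_closure \<Omega> K" "B \<in> end_nbhd_base \<Omega> K x" "C \<in> end_nbhd_base \<Omega> K x"
  shows "\<exists>D\<in>end_nbhd_base \<Omega> K x. D \<subseteq> B \<inter> C"
proof (cases x)
  case (Inl y)
  then obtain U V where "open U" "y \<in> U" "B = Inl ` (U \<inter> closure \<Omega>)"
    and "open V" "y \<in> V" "C = Inl ` (V \<inter> closure \<Omega>)"
    using assms(2,3) by auto
  then have "Inl ` ((U \<inter> V) \<inter> closure \<Omega>) \<in> end_nbhd_base \<Omega> K x"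
    and "Inl ` ((U \<inter> V) \<inter> closure \<Omega>) \<subseteq> B \<inter> C"
    using Inl by auto
  then show ?thesis by blast
next
  case (Inr F)
  then have F: "F \<in> ends \<Omega> K" using assms(1) by (auto simp: end_closure_def)
  then have anti: "antimono F"
    by (intro decseq_SucI) (auto simp: ends_def)
  have mono: "end_hat \<Omega> K F j \<subseteq> end_hat \<Omega> K F i" if "i \<le> j" for i j
    using antimonoD[OF anti that] that unfolding end_hat_def by fastforce
  obtain i j where "B = end_hat \<Omega> K F i" "C = end_hat \<Omega> K F j"
    using assms(2,3) Inr by auto
  then have "end_hat \<Omega> K F (max i j) \<subseteq> B \<inter> C" by (simp add: mono)
  then show ?thesis using Inr by auto
qed

lemma istopology_nbhd_base:
  assumes "\<And>x B C. \<lbrakk>x \<in> X; B \<in> N x; C \<in> N x\<rbrakk> \<Longrightarrow> \<exists>D\<in>N x. D \<subseteq> B \<inter> C"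
  shows "istopology (\<lambda>V. V \<subseteq> X \<and> (\<forall>x\<in>V. \<exists>B\<in>N x. B \<subseteq> V))"
proof -
  let ?O = "\<lambda>V. V \<subseteq> X \<and> (\<forall>x\<in>V. \<exists>B\<in>N x. B \<subseteq> V)"
  have "?O (S \<inter> T)" if S: "?O S" and T: "?O T" for S T
  proof (intro conjI ballI)
    show "S \<inter> T \<subseteq> X" using S by blast
    fix x assume x: "x \<in> S \<inter> T"
    obtain B C where "B \<in> N x" "B \<subseteq> S" "C \<in> N x" "C \<subseteq> T"
      using S T x by blast
    moreover have "x \<in> X" using x S by blast
    ultimately show "\<exists>D\<in>N x. D \<subseteq> S \<inter> T"
      using assms[of x B C] by blast
  qed
  moreover have "?O (\<Union>\<K>)" if K: "\<forall>V\<in>\<K>. ?O V" for \<K>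
  proof (intro conjI ballI)
    show "\<Union>\<K> \<subseteq> X" using K by blast
    fix x assume "x \<in> \<Union>\<K>"
    then obtain V where V: "V \<in> \<K>" "x \<in> V" by blast
    then obtain B where "B \<in> N x" "B \<subseteq> V" using K by blast
    then show "\<exists>B\<in>N x. B \<subseteq> \<Union>\<K>" using V by blast
  qed
  ultimately show ?thesis unfolding istopology_def by simp
qed

lemma openin_end_topology:
  "openin (end_topology \<Omega> K) V \<longleftrightarrow>
     V \<subseteq> end_closure \<Omega> K \<and> (\<forall>x\<in>V. \<exists>B\<in>end_nbhd_base \<Omega> K x. B \<subseteq> V)"
proof -
  note istopology_nbhd_base[where X = "end_closure \<Omega> K" and N = "end_nbhd_base \<Omega> K", OF end_nbhd_base_directed]
  then show ?thesis unfolding end_topology_def by (simp only: topology_inverse')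
qed

lemma topspace_end_topology [simp]: "topspace (end_topology \<Omega> K) = end_closure \<Omega> K"
proof -
  have "\<exists>B\<in>end_nbhd_base \<Omega> K x. B \<subseteq> end_closure \<Omega> K" if "x \<in> end_closure \<Omega> K" for x
  proof (cases x)
    case (Inl y)
    then have "Inl ` (UNIV \<inter> closure \<Omega>) \<in> end_nbhd_base \<Omega> K x"
      unfolding Inl end_nbhd_base.simps
      by (intro CollectI exI[of _ UNIV] conjI refl open_UNIV UNIV_I)
    moreover have "Inl ` (UNIV \<inter> closure \<Omega>) \<subseteq> end_closure \<Omega> K"
      by (simp add: end_closure_def)
    ultimately show ?thesis by (rule bexI[rotated])
  next
    case (Inr F)
    then have "F \<in> ends \<Omega> K" using that by (auto simp: end_closure_def)
    then have "F 0 \<subseteq> closure \<Omega>"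
      unfolding ends_def by (blast dest: in_components_subset)
    then have "end_hat \<Omega> K F 0 \<subseteq> end_closure \<Omega> K"
      by (auto simp: end_closure_def end_hat_def)
    then show ?thesis using Inr by (simp only: end_nbhd_base.simps) (rule bexI, assumption, rule rangeI)
  qed
  then have "openin (end_topology \<Omega> K) (end_closure \<Omega> K)"
    by (simp add: openin_end_topology)
  moreover have "topspace (end_topology \<Omega> K) \<subseteq> end_closure \<Omega> K"
    using openin_topspace[of "end_topology \<Omega> K"] by (simp only: openin_end_topology)
  ultimately show ?thesis by (intro subset_antisym openin_subset)
qed

definition end_boundary ::
  "'a::topological_space set \<Rightarrow> (nat \<Rightarrow> 'a set) \<Rightarrow> 'a end_point set" where
  "end_boundary \<Omega> K = end_closure \<Omega> K - Inl ` \<Omega>"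

definition sequentially_compact_space :: "'a topology \<Rightarrow> bool" where
  "sequentially_compact_space T \<longleftrightarrow>
     (\<forall>\<sigma>::nat \<Rightarrow> 'a. range \<sigma> \<subseteq> topspace T \<longrightarrow>
        (\<exists>l r. strict_mono r \<and> limitin T (\<sigma> \<circ> r) l sequentially))"

text \<open>The filter on the manifold describing \<open>w \<rightarrow> x\<close> with \<open>w \<in> \<Omega>\<close>.\<close>

definition within_domain ::
  "'a::topological_space set \<Rightarrow> (nat \<Rightarrow> 'a set) \<Rightarrow> 'a end_point \<Rightarrow> 'a filter" where
  "within_domain \<Omega> K x = filtercomap Inl (atin_within (end_topology \<Omega> K) x (Inl ` \<Omega>))"


section \<open>The metric compactification\<close>

text \<open>A function on \<open>\<Omega>\<close> is represented by its extensional total extension, so that equality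
  of representatives is equality on \<open>\<Omega>\<close>.\<close>

definition cont_funs :: "'a::topological_space set \<Rightarrow> ('a \<Rightarrow> real) set" where
  "cont_funs \<Omega> = {f \<in> extensional \<Omega>. continuous_on \<Omega> f}"

text \<open>Local uniform convergence is rendered as uniform convergence on compact subsets; the two
  agree because a domain of a manifold is locally compact.\<close>

definition uniform_nbhd_base ::
  "'a::topological_space set \<Rightarrow> ('a \<Rightarrow> real) \<Rightarrow> ('a \<Rightarrow> real) set set" where
  "uniform_nbhd_base \<Omega> f =
     {{g \<in> cont_funs \<Omega>. \<forall>y\<in>C. \<bar>g y - f y\<bar> < \<epsilon>} | C \<epsilon>. compact C \<and> C \<subseteq> \<Omega> \<and> \<epsilon> > 0}"

definition local_uniform_topology :: "'a::topological_space set \<Rightarrow> ('a \<Rightarrow> real) topology" where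
  "local_uniform_topology \<Omega> =
     topology (\<lambda>V. V \<subseteq> cont_funs \<Omega> \<and> (\<forall>f\<in>V. \<exists>B\<in>uniform_nbhd_base \<Omega> f. B \<subseteq> V))"

lemma uniform_nbhd_base_directed:
  assumes "B \<in> uniform_nbhd_base \<Omega> f" "B' \<in> uniform_nbhd_base \<Omega> f"
  shows "\<exists>D\<in>uniform_nbhd_base \<Omega> f. D \<subseteq> B \<inter> B'"
proof -
  obtain C \<epsilon> where C: "compact C" "C \<subseteq> \<Omega>" "\<epsilon> > 0"
    and B: "B = {g \<in> cont_funs \<Omega>. \<forall>y\<in>C. \<bar>g y - f y\<bar> < \<epsilon>}"
    using assms(1) unfolding uniform_nbhd_base_def by blast
  obtain C' \<epsilon>' where C': "compact C'" "C' \<subseteq> \<Omega>" "\<epsilon>' > 0"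
    and B': "B' = {g \<in> cont_funs \<Omega>. \<forall>y\<in>C'. \<bar>g y - f y\<bar> < \<epsilon>'}"
    using assms(2) unfolding uniform_nbhd_base_def by blast
  let ?D = "{g \<in> cont_funs \<Omega>. \<forall>y\<in>C \<union> C'. \<bar>g y - f y\<bar> < min \<epsilon> \<epsilon>'}"
  have "compact (C \<union> C')" "C \<union> C' \<subseteq> \<Omega>" "min \<epsilon> \<epsilon>' > 0"
    using C C' by auto
  then have "?D \<in> uniform_nbhd_base \<Omega> f"
    unfolding uniform_nbhd_base_def by blast
  moreover have "?D \<subseteq> B \<inter> B'" unfolding B B' by auto
  ultimately show ?thesis by blast
qed

lemma openin_local_uniform_topology:
  "openin (local_uniform_topology \<Omega>) V \<longleftrightarrow>
     V \<subseteq> cont_funs \<Omega> \<and> (\<forall>f\<in>V. \<exists>B\<in>uniform_nbhd_base \<Omega> f. B \<subseteq> V)"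
proof -
  note istopology_nbhd_base[where X = "cont_funs \<Omega>" and N = "uniform_nbhd_base \<Omega>", OF uniform_nbhd_base_directed]
  then show ?thesis unfolding local_uniform_topology_def by (simp only: topology_inverse')
qed

lemma topspace_local_uniform_topology [simp]:
  "topspace (local_uniform_topology \<Omega>) = cont_funs \<Omega>"
proof -
  have "openin (local_uniform_topology \<Omega>) (cont_funs \<Omega>)"
    unfolding openin_local_uniform_topology
  proof (intro conjI ballI subset_refl)
    fix f
    have "compact ({}::'a set) \<and> {} \<subseteq> \<Omega> \<and> (1::real) > 0" by simp
    then have "{g \<in> cont_funs \<Omega>. \<forall>y\<in>{}. \<bar>g y - f y\<bar> < 1} \<in> uniform_nbhd_base \<Omega> f"
      unfolding uniform_nbhd_base_def by blast
    then show "\<exists>B\<in>uniform_nbhd_base \<Omega> f. B \<subseteq> cont_funs \<Omega>"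
      by (rule bexI[rotated]) (rule Collect_subset)
  qed
  moreover have "topspace (local_uniform_topology \<Omega>) \<subseteq> cont_funs \<Omega>"
    using openin_topspace[of "local_uniform_topology \<Omega>"] by (simp only: openin_local_uniform_topology)
  ultimately show ?thesis by (intro subset_antisym openin_subset)
qed

definition mod_constants :: "'a::topological_space set \<Rightarrow> (('a \<Rightarrow> real) \<times> ('a \<Rightarrow> real)) set" where
  "mod_constants \<Omega> =
     {(f, g). f \<in> cont_funs \<Omega> \<and> g \<in> cont_funs \<Omega> \<and> (\<exists>c. \<forall>y\<in>\<Omega>. g y = f y + c)}"

definition const_class :: "'a::topological_space set \<Rightarrow> ('a \<Rightarrow> real) \<Rightarrow> ('a \<Rightarrow> real) set" where
  "const_class \<Omega> f = mod_constants \<Omega> `` {f}"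

definition quotient_function_topology ::
  "'a::topological_space set \<Rightarrow> ('a \<Rightarrow> real) set topology" where
  "quotient_function_topology \<Omega> =
     topology (\<lambda>\<V>. \<V> \<subseteq> cont_funs \<Omega> // mod_constants \<Omega> \<and>
       openin (local_uniform_topology \<Omega>) {f \<in> cont_funs \<Omega>. const_class \<Omega> f \<in> \<V>})"

lemma openin_quotient_function_topology:
  "openin (quotient_function_topology \<Omega>) \<V> \<longleftrightarrow>
     \<V> \<subseteq> cont_funs \<Omega> // mod_constants \<Omega> \<and>
     openin (local_uniform_topology \<Omega>) {f \<in> cont_funs \<Omega>. const_class \<Omega> f \<in> \<V>}"
proof -
  let ?P = "\<lambda>\<V>. {f \<in> cont_funs \<Omega>. const_class \<Omega> f \<in> \<V>}"
  have "istopology (\<lambda>\<V>. \<V> \<subseteq> cont_funs \<Omega> // mod_constants \<Omega> \<and>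
       openin (local_uniform_topology \<Omega>) (?P \<V>))"
    unfolding istopology_def
  proof (intro conjI allI impI, goal_cases)
    case (2 S T)
    have "?P (S \<inter> T) = ?P S \<inter> ?P T" by blast
    then show ?case using 2 by (simp add: openin_Int)
  next
    case (4 \<K>)
    have "?P (\<Union>\<K>) = \<Union>(?P ` \<K>)" by blast
    moreover have "openin (local_uniform_topology \<Omega>) (\<Union>(?P ` \<K>))"
      using 4 by (intro openin_Union) blast
    ultimately show ?case by metis
  qed blast+
  then show ?thesis by (simp add: quotient_function_topology_def)
qed

lemma topspace_quotient_function_topology [simp]:
  "topspace (quotient_function_topology \<Omega>) = cont_funs \<Omega> // mod_constants \<Omega>"
proof -
  have "{f \<in> cont_funs \<Omega>. const_class \<Omega> f \<in> cont_funs \<Omega> // mod_constants \<Omega>} = cont_funs \<Omega>"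
    by (auto simp: const_class_def quotientI)
  moreover have "openin (local_uniform_topology \<Omega>) (cont_funs \<Omega>)"
    by (metis openin_topspace topspace_local_uniform_topology)
  ultimately have "openin (quotient_function_topology \<Omega>) (cont_funs \<Omega> // mod_constants \<Omega>)"
    by (simp add: openin_quotient_function_topology)
  moreover have "topspace (quotient_function_topology \<Omega>) \<subseteq> cont_funs \<Omega> // mod_constants \<Omega>"
    using openin_topspace[of "quotient_function_topology \<Omega>"] by (simp only: openin_quotient_function_topology)
  ultimately show ?thesis by (intro subset_antisym openin_subset)
qed

definition metric_embedding ::
  "('a::topological_space, 'n::finite) chart set \<Rightarrow> 'a set \<Rightarrow> 'a \<Rightarrow> ('a \<Rightarrow> real) set" where
  "metric_embedding A \<Omega> x = const_class \<Omega> (restrict (kobayashi A \<Omega> x) \<Omega>)"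

definition metric_compactification ::
  "('a::topological_space, 'n::finite) chart set \<Rightarrow> 'a set \<Rightarrow> ('a \<Rightarrow> real) set set" where
  "metric_compactification A \<Omega> =
     quotient_function_topology \<Omega> closure_of (metric_embedding A \<Omega> ` \<Omega>)"

definition metric_boundary ::
  "('a::topological_space, 'n::finite) chart set \<Rightarrow> 'a set \<Rightarrow> ('a \<Rightarrow> real) set set" where
  "metric_boundary A \<Omega> = metric_compactification A \<Omega> - metric_embedding A \<Omega> ` \<Omega>"


section \<open>Horofunctions, horoballs and horospheres\<close>

definition horofunction :: "'a \<Rightarrow> ('a \<Rightarrow> real) set \<Rightarrow> 'a \<Rightarrow> real" where
  "horofunction p \<xi> = (THE h. h \<in> \<xi> \<and> h p = 0)"

definition horoball :: "'a set \<Rightarrow> 'a \<Rightarrow> ('a \<Rightarrow> real) set \<Rightarrow> real \<Rightarrow> 'a set" where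
  "horoball \<Omega> p \<xi> R = {z \<in> \<Omega>. horofunction p \<xi> z < ln R / 2}"

definition horo_limits ::
  "('a::topological_space, 'n::finite) chart set \<Rightarrow> 'a set \<Rightarrow> (nat \<Rightarrow> 'a set) \<Rightarrow> 'a end_point
     \<Rightarrow> ('a \<Rightarrow> real) set set" where
  "horo_limits A \<Omega> K x =
     {\<xi> \<in> metric_boundary A \<Omega>. \<exists>\<sigma>::nat \<Rightarrow> 'a. range \<sigma> \<subseteq> \<Omega> \<and>
        limitin (end_topology \<Omega> K) (Inl \<circ> \<sigma>) x sequentially \<and>
        limitin (quotient_function_topology \<Omega>) (metric_embedding A \<Omega> \<circ> \<sigma>) \<xi> sequentially}"

definition big_horosphere ::
  "('a::topological_space, 'n::finite) chart set \<Rightarrow> 'a set \<Rightarrow> (nat \<Rightarrow> 'a set) \<Rightarrow> 'a \<Rightarrow> 'a end_point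
     \<Rightarrow> real \<Rightarrow> 'a set" where
  "big_horosphere A \<Omega> K p x R =
     {z \<in> \<Omega>. Liminf (within_domain \<Omega> K x) (\<lambda>w. ereal (kobayashi A \<Omega> z w - kobayashi A \<Omega> p w))
              < ereal (ln R / 2)}"

definition small_horosphere ::
  "('a::topological_space, 'n::finite) chart set \<Rightarrow> 'a set \<Rightarrow> (nat \<Rightarrow> 'a set) \<Rightarrow> 'a \<Rightarrow> 'a end_point
     \<Rightarrow> real \<Rightarrow> 'a set" where
  "small_horosphere A \<Omega> K p x R =
     {z \<in> \<Omega>. Limsup (within_domain \<Omega> K x) (\<lambda>w. ereal (kobayashi A \<Omega> z w - kobayashi A \<Omega> p w))
              < ereal (ln R / 2)}"

end

theory Submission
  imports Defs "HOL-Complex_Analysis.Riemann_Mapping" "HOL-Complex_Analysis.Great_Picard"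
begin

text \<open>
  Write \<open>k\<close> for the Kobayashi distance and \<open>\<phi>\<^sub>z w = k z w - k p w\<close>.  If \<open>w\<^sub>n \<rightarrow> x\<close> and
  \<open>[k w\<^sub>n] \<rightarrow> \<xi>\<close> in the metric compactification, then \<open>\<phi>\<^sub>z w\<^sub>n\<close> tends to \<open>h\<^sub>\<xi> z\<close>, where
  \<open>[f]\<close> is the class of \<open>f\<close> modulo constants and \<open>h\<^sub>\<xi>\<close> is the horofunction of \<open>\<xi>\<close> normalised at \<open>p\<close>.
  So the values \<open>h\<^sub>\<xi> z\<close>, for \<open>\<xi>\<close> among the horo-limits of \<open>x\<close>, are cluster values of
  \<open>\<phi>\<^sub>z\<close> at \<open>x\<close>.  If every sequence tending to \<open>x\<close> has such a subsequence, they are all the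
  cluster values; in particular the lower and the upper limit of \<open>\<phi>\<^sub>z\<close> at \<open>x\<close> are the smallest
  and the largest value of \<open>h\<^sub>\<xi> z\<close>, and both are attained.  In terms of strict sublevel sets
  this is the theorem.  Three ingredients are required.

  Compactness.  The functions \<open>k w - k w p\<close> are nonexpansive for \<open>k\<close> and vanish at
  \<open>p\<close>, and small discs in charts show that \<open>k\<close> is continuous; an Ascoli argument then gives
  locally uniformly convergent subsequences (\<open>nonexpansive_convergent_subsequence\<close>).

  The limit is a boundary point.  The limit class must differ from every \<open>[k q]\<close>.
  The Kobayashi distance is a length distance: a chain of discs from \<open>q\<close> to a far point \<open>w\<close>
  crosses the shell \<open>D - B\<close> around \<open>q\<close>, and there it can be cut without loss,
  because Poincare geodesics split additively (\<open>kobayashi_approximate_crossing\<close>).  So some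
  \<open>s\<close> in the shell has \<open>k w s - k w q\<close> at most about \<open>- k q s\<close>, and this is bounded away
  from zero; but if \<open>[k w\<^sub>n]\<close> tended to \<open>[k q]\<close>, this difference would be close to
  \<open>+ k q s\<close> (\<open>escaping_limit_not_embedded\<close>).

  Sequences suffice at \<open>x\<close>.  At an end this is delicate: the closure of the domain need not be locally
  connected, so the components \<open>F j\<close> that describe an end need not be open.  Sequential
  compactness repairs this.  It forces every sequence leaving the exhaustion to enter, along a
  subsequence, all components of a single end; hence only finitely many components of the
  complement of \<open>K j\<close> reach beyond some \<open>K m\<close>, and each of them is open outside \<open>K m\<close>
  (\<open>end_component_eventually_open\<close>).  So the sets \<open>F j\<close> do describe the filter of approach
  to the end, and they meet the domain.
\<close>

section \<open>Convergence of functions modulo constants\<close>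

lemma nonexpansive_continuous_on:
  fixes d :: "'a::t2_space \<Rightarrow> 'a \<Rightarrow> real" and h :: "'a \<Rightarrow> real"
  assumes small: "\<And>q \<epsilon>. q \<in> \<Omega> \<Longrightarrow> \<epsilon> > 0 \<Longrightarrow> \<exists>N. open N \<and> q \<in> N \<and> N \<subseteq> \<Omega> \<and> (\<forall>w\<in>N. d q w < \<epsilon>)"
    and lip: "\<And>y z. y \<in> \<Omega> \<Longrightarrow> z \<in> \<Omega> \<Longrightarrow> \<bar>h y - h z\<bar> \<le> d y z"
  shows "continuous_on \<Omega> h"
proof (intro continuous_at_imp_continuous_on ballI)
  fix q assume q: "q \<in> \<Omega>"
  show "isCont h q"
    unfolding isCont_def
  proof (rule tendstoI)
    fix \<epsilon> :: real assume "\<epsilon> > 0"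
    then obtain N where N: "open N" "q \<in> N" "N \<subseteq> \<Omega>" "\<forall>w\<in>N. d q w < \<epsilon>"
      using small[OF q] by metis
    have "dist (h w) (h q) < \<epsilon>" if "w \<in> N" for w
    proof -
      have "\<bar>h q - h w\<bar> \<le> d q w" using lip q N(3) that by blast
      then show ?thesis using bspec[OF N(4) that] by (simp add: dist_real_def)
    qed
    then show "\<forall>\<^sub>F w in at q. dist (h w) (h q) < \<epsilon>"
      unfolding eventually_at_topological using N(1,2) by blast
  qed
qed

text \<open>Ascoli's theorem for functions that are nonexpansive with respect to a distance \<open>d\<close> which is
  continuous for the given topology.  A diagonal sequence converges on a countable dense set; the \<open>d\<close>-balls
  around the points of that set are open, so finitely many small ones cover a compact set, and
  nonexpansiveness carries the convergence from their centres to all points.\<close>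

lemma nonexpansive_convergent_subsequence:
  fixes \<Omega> :: "'a::second_countable_topology set" and f :: "nat \<Rightarrow> 'a \<Rightarrow> real"
  assumes met: "Metric_space \<Omega> d" and "open \<Omega>"
    and small: "\<And>q \<epsilon>. q \<in> \<Omega> \<Longrightarrow> \<epsilon> > 0 \<Longrightarrow> \<exists>N. open N \<and> q \<in> N \<and> N \<subseteq> \<Omega> \<and> (\<forall>w\<in>N. d q w < \<epsilon>)"
    and lip: "\<And>n y z. y \<in> \<Omega> \<Longrightarrow> z \<in> \<Omega> \<Longrightarrow> \<bar>f n y - f n z\<bar> \<le> d y z"
    and p: "p \<in> \<Omega>" "\<And>n. f n p = 0"
  obtains r h where "strict_mono r" "\<forall>y\<in>\<Omega>. \<forall>z\<in>\<Omega>. \<bar>h y - h z\<bar> \<le> d y z"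
    "\<forall>C. compact C \<and> C \<subseteq> \<Omega> \<longrightarrow> uniform_limit C (\<lambda>n. f (r n)) h sequentially"
proof -
  interpret Metric_space \<Omega> d by (rule met)
  obtain D0 :: "'a set" where D0: "countable D0" "\<And>X. open X \<Longrightarrow> X \<noteq> {} \<Longrightarrow> \<exists>t\<in>D0. t \<in> X"
    using countable_dense_setE by blast
  define D where "D = D0 \<inter> \<Omega>"
  have D: "countable D" "D \<subseteq> \<Omega>" using D0(1) by (auto simp: D_def)
  have dense: "\<exists>t\<in>D. d t z < \<epsilon>" if z: "z \<in> \<Omega>" and "\<epsilon> > 0" for z \<epsilon>
  proof -
    obtain N where N: "open N" "z \<in> N" "N \<subseteq> \<Omega>" "\<forall>w\<in>N. d z w < \<epsilon>"
      using small[OF z \<open>\<epsilon> > 0\<close>] by blast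
    then obtain t where "t \<in> D0" "t \<in> N" using D0(2)[of N] by blast
    then show ?thesis using N(3,4) by (intro bexI[of _ t]) (auto simp: D_def commute)
  qed
  have op: "open {w \<in> \<Omega>. d t w < \<epsilon>}" if t: "t \<in> \<Omega>" for t \<epsilon>
  proof (subst open_subopen, intro ballI)
    fix w assume "w \<in> {w \<in> \<Omega>. d t w < \<epsilon>}"
    then have w: "w \<in> \<Omega>" "\<epsilon> - d t w > 0" by auto
    obtain N where N: "open N" "w \<in> N" "N \<subseteq> \<Omega>" "\<forall>v\<in>N. d w v < \<epsilon> - d t w"
      using small[OF w] by blast
    have "N \<subseteq> {w \<in> \<Omega>. d t w < \<epsilon>}"
    proof
      fix v assume "v \<in> N"
      then have v: "v \<in> \<Omega>" "d w v < \<epsilon> - d t w" using N(3,4) by auto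
      then show "v \<in> {w \<in> \<Omega>. d t w < \<epsilon>}" using triangle[OF t w(1) v(1)] by simp
    qed
    then show "\<exists>T. open T \<and> w \<in> T \<and> T \<subseteq> {w \<in> \<Omega>. d t w < \<epsilon>}" using N(1,2) by blast
  qed
  \<comment> \<open>Rescaling makes the sequence uniformly bounded on \<open>D\<close>, as the diagonal argument demands.\<close>
  define g where "g n y = f n y / (1 + d p y)" for n y
  have "norm (g n y) \<le> 1" if "y \<in> D" for n y
  proof -
    have "\<bar>f n y\<bar> \<le> d y p" using lip[of y p n] that D(2) p by auto
    then show ?thesis by (simp add: g_def commute[of y p] divide_le_eq_1 add_pos_nonneg)
  qed
  then obtain r where r: "strict_mono (r :: nat \<Rightarrow> nat)"
    and conv: "\<And>y. y \<in> D \<Longrightarrow> \<exists>l. (\<lambda>n. g (r n) y) \<longlonglongrightarrow> l"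
    using function_convergent_subsequence[OF D(1), of g 1] by blast
  have convD: "Cauchy (\<lambda>n. f (r n) t)" if t: "t \<in> D" for t
  proof -
    obtain l where "(\<lambda>n. g (r n) t) \<longlonglongrightarrow> l" using conv[OF t] by blast
    then have "(\<lambda>n. (1 + d p t) * g (r n) t) \<longlonglongrightarrow> (1 + d p t) * l" by (rule tendsto_mult_left)
    moreover have "1 + d p t \<noteq> 0" using nonneg[of p t] by linarith
    then have "(1 + d p t) * g (r n) t = f (r n) t" for n by (simp add: g_def)
    ultimately show ?thesis using LIMSEQ_imp_Cauchy by auto
  qed
  have "convergent (\<lambda>n. f (r n) z)" if z: "z \<in> \<Omega>" for z
    unfolding Cauchy_convergent_iff[symmetric]
  proof (rule metric_CauchyI)
    fix \<epsilon> :: real assume "\<epsilon> > 0"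
    then obtain t where t: "t \<in> D" "d t z < \<epsilon> / 3" using dense[OF z, of "\<epsilon> / 3"] by auto
    obtain M where M: "\<And>m n. m \<ge> M \<Longrightarrow> n \<ge> M \<Longrightarrow> \<bar>f (r m) t - f (r n) t\<bar> < \<epsilon> / 3"
      using metric_CauchyD[OF convD[OF t(1)], of "\<epsilon> / 3"] \<open>\<epsilon> > 0\<close> unfolding dist_real_def by auto
    have tz: "\<bar>f (r n) t - f (r n) z\<bar> < \<epsilon> / 3" for n
      using lip[of t z "r n"] t z D(2) by force
    have "dist (f (r m) z) (f (r n) z) < \<epsilon>" if "m \<ge> M" "n \<ge> M" for m n
      using M[OF that] tz[of m] tz[of n] unfolding dist_real_def by linarith
    then show "\<exists>M. \<forall>m\<ge>M. \<forall>n\<ge>M. dist (f (r m) z) (f (r n) z) < \<epsilon>" by blast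
  qed
  then have "\<forall>z. \<exists>l. z \<in> \<Omega> \<longrightarrow> (\<lambda>n. f (r n) z) \<longlonglongrightarrow> l" by (auto simp: convergent_def)
  then obtain h where h: "\<And>z. z \<in> \<Omega> \<Longrightarrow> (\<lambda>n. f (r n) z) \<longlonglongrightarrow> h z" by metis
  have hlip: "\<bar>h y - h z\<bar> \<le> d y z" if "y \<in> \<Omega>" "z \<in> \<Omega>" for y z
  proof (rule tendsto_upperbound)
    show "(\<lambda>n. \<bar>f (r n) y - f (r n) z\<bar>) \<longlonglongrightarrow> \<bar>h y - h z\<bar>"
      using h that by (intro tendsto_intros)
  qed (use lip that in auto)
  have "uniform_limit C (\<lambda>n. f (r n)) h sequentially" if C: "compact C" "C \<subseteq> \<Omega>" for C
  proof (rule uniform_limitI)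
    fix \<epsilon> :: real assume "\<epsilon> > 0"
    define U where "U t = {w \<in> \<Omega>. d t w < \<epsilon> / 3}" for t
    have "C \<subseteq> \<Union>(U ` D)"
    proof
      fix z assume "z \<in> C"
      then show "z \<in> \<Union>(U ` D)"
        using dense[of z "\<epsilon> / 3"] C(2) \<open>\<epsilon> > 0\<close> unfolding U_def by auto
    qed
    moreover have "open V" if "V \<in> U ` D" for V using that op D(2) unfolding U_def by blast
    ultimately obtain T where T: "T \<subseteq> U ` D" "finite T" "C \<subseteq> \<Union>T"
      using compactE[OF C(1), of "U ` D"] by metis
    obtain D' where D': "D' \<subseteq> D" "finite D'" "T = U ` D'" using finite_subset_image[OF T(2,1)] by blast
    have "\<forall>t\<in>D'. \<forall>\<^sub>F n in sequentially. dist (f (r n) t) (h t) < \<epsilon> / 3"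
      using D' D(2) h \<open>\<epsilon> > 0\<close> by (intro ballI tendstoD) auto
    then have "\<forall>\<^sub>F n in sequentially. \<forall>t\<in>D'. dist (f (r n) t) (h t) < \<epsilon> / 3"
      using D'(2) by (simp add: eventually_ball_finite)
    then show "\<forall>\<^sub>F n in sequentially. \<forall>z\<in>C. dist (f (r n) z) (h z) < \<epsilon>"
    proof (rule eventually_mono, intro ballI)
      fix n z assume n: "\<forall>t\<in>D'. dist (f (r n) t) (h t) < \<epsilon> / 3" and "z \<in> C"
      then obtain t where t: "t \<in> D'" "z \<in> U t" using T(3) D'(3) by blast
      then have tz: "t \<in> \<Omega>" "z \<in> \<Omega>" "d t z < \<epsilon> / 3" using D' D(2) by (auto simp: U_def)
      have "\<bar>f (r n) t - h t\<bar> < \<epsilon> / 3" using n t(1) by (simp add: dist_real_def)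
      then show "dist (f (r n) z) (h z) < \<epsilon>"
        using lip[OF tz(1,2), of "r n"] hlip[OF tz(1,2)] tz(3) unfolding dist_real_def by linarith
    qed
  qed
  then show thesis using hlip by (intro that[OF r, of h]) simp_all
qed

lemma mod_constants_equiv: "equiv (cont_funs \<Omega>) (mod_constants \<Omega>)"
proof (rule equivI)
  show "refl_on (cont_funs \<Omega>) (mod_constants \<Omega>)"
    by (auto simp: refl_on_def mod_constants_def intro: exI[of _ 0])
  show "sym (mod_constants \<Omega>)"
  proof (rule symI)
    fix f g assume "(f, g) \<in> mod_constants \<Omega>"
    then obtain c where "f \<in> cont_funs \<Omega>" "g \<in> cont_funs \<Omega>" "\<forall>y\<in>\<Omega>. g y = f y + c"
      by (auto simp: mod_constants_def)
    then show "(g, f) \<in> mod_constants \<Omega>"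
      by (auto simp: mod_constants_def intro!: exI[of _ "- c"])
  qed
  show "trans (mod_constants \<Omega>)"
  proof (rule transI)
    fix f g h assume "(f, g) \<in> mod_constants \<Omega>" "(g, h) \<in> mod_constants \<Omega>"
    then have fh: "f \<in> cont_funs \<Omega>" "h \<in> cont_funs \<Omega>"
      and "\<exists>b. \<forall>y\<in>\<Omega>. g y = f y + b" "\<exists>c. \<forall>y\<in>\<Omega>. h y = g y + c"
      by (simp_all add: mod_constants_def)
    then obtain b c where "\<forall>y\<in>\<Omega>. g y = f y + b" "\<forall>y\<in>\<Omega>. h y = g y + c" by blast
    with fh show "(f, h) \<in> mod_constants \<Omega>"
      by (auto simp: mod_constants_def intro!: exI[of _ "b + c"])
  qed
qed (auto simp: mod_constants_def)

lemma const_class_eq_iff: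
  assumes "f \<in> cont_funs \<Omega>" "g \<in> cont_funs \<Omega>"
  shows "const_class \<Omega> f = const_class \<Omega> g \<longleftrightarrow> (\<exists>c. \<forall>y\<in>\<Omega>. g y = f y + c)"
  using eq_equiv_class_iff[OF mod_constants_equiv assms] assms
  by (auto simp: const_class_def mod_constants_def)

lemma const_class_in_quotient: "f \<in> cont_funs \<Omega> \<Longrightarrow> const_class \<Omega> f \<in> cont_funs \<Omega> // mod_constants \<Omega>"
  unfolding const_class_def by (rule quotientI)

lemma horofunction_const_class:
  assumes f: "f \<in> cont_funs \<Omega>" and p: "p \<in> \<Omega>" and z: "z \<in> \<Omega>"
  shows "horofunction p (const_class \<Omega> f) z = f z - f p"
proof -
  let ?h = "restrict (\<lambda>y. f y - f p) \<Omega>"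
  have "continuous_on \<Omega> ?h"
    using f by (auto simp: cont_funs_def intro!: continuous_intros cong: continuous_on_cong)
  then have "?h \<in> const_class \<Omega> f \<and> ?h p = 0"
    using f p by (auto simp: const_class_def mod_constants_def cont_funs_def intro!: exI[of _ "- f p"])
  moreover have "g = ?h" if g: "g \<in> const_class \<Omega> f \<and> g p = 0" for g
  proof -
    have "g \<in> cont_funs \<Omega> \<and> (\<exists>c. \<forall>y\<in>\<Omega>. g y = f y + c)"
      using g by (auto simp: const_class_def mod_constants_def)
    then obtain c where c: "g \<in> cont_funs \<Omega>" "\<forall>y\<in>\<Omega>. g y = f y + c" by blast
    then have "c = - f p" using g p by auto
    then show ?thesis using c by (auto simp: cont_funs_def extensional_def)
  qed
  ultimately have "horofunction p (const_class \<Omega> f) = ?h"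
    unfolding horofunction_def by (rule the_equality)
  then show ?thesis using z by simp
qed

lemma limitin_const_class:
  assumes f: "\<And>n. f n \<in> cont_funs \<Omega>" and h: "h \<in> cont_funs \<Omega>"
    and lim: "\<And>C. compact C \<Longrightarrow> C \<subseteq> \<Omega> \<Longrightarrow> uniform_limit C f h F"
  shows "limitin (quotient_function_topology \<Omega>) (\<lambda>n. const_class \<Omega> (f n)) (const_class \<Omega> h) F"
  unfolding limitin_def
proof (intro conjI allI impI)
  show "const_class \<Omega> h \<in> topspace (quotient_function_topology \<Omega>)"
    using const_class_in_quotient[OF h] by simp
  fix \<V> assume V: "openin (quotient_function_topology \<Omega>) \<V> \<and> const_class \<Omega> h \<in> \<V>"
  let ?P = "{f \<in> cont_funs \<Omega>. const_class \<Omega> f \<in> \<V>}"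
  have "openin (local_uniform_topology \<Omega>) ?P" "h \<in> ?P"
    using V h by (auto simp: openin_quotient_function_topology)
  then obtain B where "B \<in> uniform_nbhd_base \<Omega> h" "B \<subseteq> ?P"
    unfolding openin_local_uniform_topology by blast
  then obtain C \<epsilon> where C: "compact C" "C \<subseteq> \<Omega>" "\<epsilon> > 0"
    and B: "B = {g \<in> cont_funs \<Omega>. \<forall>y\<in>C. \<bar>g y - h y\<bar> < \<epsilon>}"
    unfolding uniform_nbhd_base_def by blast
  then have sub: "{g \<in> cont_funs \<Omega>. \<forall>y\<in>C. \<bar>g y - h y\<bar> < \<epsilon>} \<subseteq> ?P" using \<open>B \<subseteq> ?P\<close> by simp
  have "\<forall>\<^sub>F n in F. \<forall>y\<in>C. dist (f n y) (h y) < \<epsilon>"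
    using uniform_limitD[OF lim[OF C(1,2)] C(3)] .
  then show "\<forall>\<^sub>F n in F. const_class \<Omega> (f n) \<in> \<V>"
    by (rule eventually_mono) (use sub f in \<open>auto simp: dist_real_def\<close>)
qed

text \<open>The values \<open>f z - f p\<close> depend only on the class of \<open>f\<close>, and they vary continuously with \<open>f\<close>, so
  the inequality defining a neighbourhood of the limit value defines an open set of classes.\<close>

lemma limitin_const_class_pointwise:
  fixes \<Omega> :: "'a::topological_space set" and f :: "'b \<Rightarrow> 'a \<Rightarrow> real"
  assumes f: "\<And>n. f n \<in> cont_funs \<Omega>" and h: "h \<in> cont_funs \<Omega>" and z: "z \<in> \<Omega>" "p \<in> \<Omega>"
    and lim: "limitin (quotient_function_topology \<Omega>) (\<lambda>n. const_class \<Omega> (f n)) (const_class \<Omega> h) F"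
  shows "((\<lambda>n. f n z - f n p) \<longlongrightarrow> h z - h p) F"
proof (rule tendstoI)
  fix \<epsilon> :: real assume "\<epsilon> > 0"
  define Q where "Q g \<longleftrightarrow> \<bar>(g z - g p) - (h z - h p)\<bar> < \<epsilon>" for g :: "'a \<Rightarrow> real"
  define \<V> where "\<V> = const_class \<Omega> ` {g \<in> cont_funs \<Omega>. Q g}"
  have mem: "const_class \<Omega> g \<in> \<V> \<longleftrightarrow> Q g" if g: "g \<in> cont_funs \<Omega>" for g
  proof
    assume "const_class \<Omega> g \<in> \<V>"
    then obtain g' where g': "g' \<in> cont_funs \<Omega>" "Q g'" "const_class \<Omega> g = const_class \<Omega> g'"
      unfolding \<V>_def by blast
    then obtain c where "\<forall>y\<in>\<Omega>. g' y = g y + c" using const_class_eq_iff[OF g g'(1)] by blast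
    then show "Q g" using g'(2) z by (simp add: Q_def)
  qed (use g in \<open>auto simp: \<V>_def\<close>)
  have "openin (local_uniform_topology \<Omega>) {g \<in> cont_funs \<Omega>. Q g}"
    unfolding openin_local_uniform_topology
  proof (intro conjI ballI)
    fix g assume "g \<in> {g \<in> cont_funs \<Omega>. Q g}"
    then have g: "g \<in> cont_funs \<Omega>" "Q g" by auto
    define \<delta> where "\<delta> = (\<epsilon> - \<bar>(g z - g p) - (h z - h p)\<bar>) / 2"
    have \<delta>2: "2 * \<delta> = \<epsilon> - \<bar>(g z - g p) - (h z - h p)\<bar>" by (simp add: \<delta>_def)
    have \<delta>: "\<delta> > 0" using g(2) by (simp add: \<delta>_def Q_def)
    let ?B = "{g' \<in> cont_funs \<Omega>. \<forall>y\<in>{z, p}. \<bar>g' y - g y\<bar> < \<delta>}"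
    have "compact {z, p} \<and> {z, p} \<subseteq> \<Omega> \<and> \<delta> > 0" using z \<delta> by (simp add: finite_imp_compact)
    then have "?B \<in> uniform_nbhd_base \<Omega> g" unfolding uniform_nbhd_base_def by blast
    moreover have "?B \<subseteq> {g \<in> cont_funs \<Omega>. Q g}"
    proof
      fix g' assume "g' \<in> ?B"
      then have "g' \<in> cont_funs \<Omega>" "\<bar>g' z - g z\<bar> < \<delta>" "\<bar>g' p - g p\<bar> < \<delta>" by auto
      moreover from this have "Q g'"
        using \<delta>2 unfolding Q_def by linarith
      ultimately show "g' \<in> {g \<in> cont_funs \<Omega>. Q g}" by simp
    qed
    ultimately show "\<exists>B\<in>uniform_nbhd_base \<Omega> g. B \<subseteq> {g \<in> cont_funs \<Omega>. Q g}" by blast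
  qed auto
  moreover have "{g \<in> cont_funs \<Omega>. const_class \<Omega> g \<in> \<V>} = {g \<in> cont_funs \<Omega>. Q g}"
    using mem by auto
  ultimately have "openin (quotient_function_topology \<Omega>) \<V>"
    unfolding openin_quotient_function_topology \<V>_def by (auto intro: const_class_in_quotient)
  moreover have "const_class \<Omega> h \<in> \<V>" using mem[OF h] \<open>\<epsilon> > 0\<close> by (simp add: Q_def)
  ultimately have "\<forall>\<^sub>F n in F. const_class \<Omega> (f n) \<in> \<V>" by (rule limitinD[OF lim])
  then show "\<forall>\<^sub>F n in F. dist (f n z - f n p) (h z - h p) < \<epsilon>"
    by (rule eventually_mono) (simp add: mem[OF f] Q_def dist_real_def)
qed

section \<open>Geodesics of the Poincare distance\<close>

lemma unit_disc_denominator_nonzero: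
  assumes "cmod a < 1" "cmod z < 1"
  shows "1 - cnj a * z \<noteq> 0"
proof
  assume "1 - cnj a * z = 0"
  then have "cmod (cnj a * z) = 1" by (metis eq_iff_diff_eq_0 norm_one)
  moreover have "cmod (cnj a * z) < 1"
    using norm_mult_less[of "cnj a" 1 z 1] assms by simp
  ultimately show False by simp
qed

lemma poincare_dist_Moebius: "poincare_dist z w = artanh (cmod (Moebius_function 0 w z))"
  by (simp add: poincare_dist_def Moebius_function_simple)

lemma poincare_dist_nonneg:
  assumes "z \<in> ball 0 1" "w \<in> ball 0 1"
  shows "poincare_dist z w \<ge> 0"
proof -
  have "cmod (Moebius_function 0 w z) < 1"
    using assms by (intro Moebius_function_norm_lt_1) auto
  then show ?thesis by (simp add: poincare_dist_Moebius artanh_def)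
qed

lemma poincare_dist_commute: "poincare_dist z w = poincare_dist w z"
proof -
  have "cnj (1 - cnj w * z) = 1 - cnj z * w" by (simp add: mult.commute)
  then have "cmod (1 - cnj w * z) = cmod (1 - cnj z * w)" by (metis complex_mod_cnj)
  then show ?thesis
    by (simp add: poincare_dist_def norm_divide norm_minus_commute)
qed

lemma poincare_dist_Moebius_invariant:
  assumes "cmod a < 1" "cmod z < 1" "cmod w < 1"
  shows "poincare_dist (Moebius_function 0 a z) (Moebius_function 0 a w) = poincare_dist z w"
proof -
  define A B D where "A = 1 - cnj a * z" "B = 1 - cnj a * w" "D = 1 - cnj w * z"
  define q where "q = 1 - a * cnj a"
  have nz: "A \<noteq> 0" "B \<noteq> 0" "D \<noteq> 0" "q \<noteq> 0"
    using assms unit_disc_denominator_nonzero[of a z] unit_disc_denominator_nonzero[of a w]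
      unit_disc_denominator_nonzero[of w z] unit_disc_denominator_nonzero[of a a]
    unfolding A_B_D_def q_def by (auto simp: mult.commute)
  let ?u = "Moebius_function 0 a z" and ?v = "Moebius_function 0 a w"
  have u: "?u = (z - a) / A" and v: "?v = (w - a) / B"
    by (simp_all add: Moebius_function_simple A_B_D_def)
  have num: "?u - ?v = (z - w) * q / (A * B)"
    unfolding u v diff_frac_eq[OF nz(1,2)]
    by (rule arg_cong2[where f = "(/)"]) (simp_all add: A_B_D_def q_def algebra_simps)
  have cB: "cnj B \<noteq> 0" using nz by simp
  have "1 - cnj ?v * ?u = (cnj B * A - (cnj w - cnj a) * (z - a)) / (cnj B * A)"
    unfolding u v using nz cB by (simp add: field_simps)
  also have "cnj B * A - (cnj w - cnj a) * (z - a) = q * D"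
    by (simp add: A_B_D_def q_def algebra_simps)
  finally have den: "1 - cnj ?v * ?u = q * D / (cnj B * A)" .
  have "(?u - ?v) / (1 - cnj ?v * ?u) = (z - w) / D * (cnj B / B)"
    unfolding num den using nz cB by (simp add: field_simps)
  then have "cmod ((?u - ?v) / (1 - cnj ?v * ?u)) = cmod ((z - w) / D)"
    using nz by (simp add: norm_mult norm_divide)
  then show ?thesis by (simp add: poincare_dist_def A_B_D_def)
qed

text \<open>On a radius the distance is \<open>artanh\<close> of the pseudohyperbolic distance
  \<open>(1 - t) r / (1 - t r\<^sup>2)\<close>, and the claim is the addition theorem of \<open>artanh\<close>.\<close>

lemma poincare_dist_radius_additive:
  assumes b: "cmod b < 1" and t: "0 \<le> t" "t \<le> 1"
  shows "poincare_dist 0 (t *\<^sub>R b) + poincare_dist (t *\<^sub>R b) b = poincare_dist 0 b"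
proof -
  define r where "r = cmod b"
  have r: "0 \<le> r" "r < 1" using b by (auto simp: r_def)
  have tr: "t * r < 1" using mult_right_mono[OF t(2) r(1)] r by simp
  have "t * r * r \<le> 1 * r" using tr r by (intro mult_right_mono) auto
  then have trr: "t * r\<^sup>2 < 1" using r by (simp add: power2_eq_square)
  have "t *\<^sub>R b - b = (t - 1) *\<^sub>R b" by (simp add: algebra_simps)
  then have num: "cmod (t *\<^sub>R b - b) = (1 - t) * r" using t by (simp add: r_def)
  have "1 - cnj b * t *\<^sub>R b = of_real (1 - t * r\<^sup>2)"
    using complex_norm_square[of b] by (simp add: r_def scaleR_conv_of_real mult_ac)
  then have den: "cmod (1 - cnj b * t *\<^sub>R b) = 1 - t * r\<^sup>2"
    using trr by (metis abs_of_pos diff_gt_0_iff_gt norm_of_real)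
  have 1: "poincare_dist 0 b = artanh r" "poincare_dist 0 (t *\<^sub>R b) = artanh (t * r)"
    using t by (simp_all add: poincare_dist_def r_def)
  have 2: "poincare_dist (t *\<^sub>R b) b = artanh ((1 - t) * r / (1 - t * r\<^sup>2))"
    unfolding poincare_dist_def norm_divide num den ..
  define s where "s = (1 - t) * r / (1 - t * r\<^sup>2)"
  have p: "1 + s = (1 + r) * (1 - t * r) / (1 - t * r\<^sup>2)"
          "1 - s = (1 - r) * (1 + t * r) / (1 - t * r\<^sup>2)"
    unfolding s_def using trr by (simp_all add: field_simps power2_eq_square)
  have "(1 + s) / (1 - s) = ((1 + r) * (1 - t * r)) / ((1 - r) * (1 + t * r))"
    unfolding p using trr by simp
  moreover have tr0: "1 + t * r > 0" using t r by (simp add: add_pos_nonneg)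
  moreover have "X / Y * ((P * Y) / (Q * X)) = P / Q" if "X > 0" "Y > 0" for X Y P Q :: real
    using that by simp
  ultimately have "(1 + t * r) / (1 - t * r) * ((1 + s) / (1 - s)) = (1 + r) / (1 - r)"
    using tr by simp
  moreover have "(1 + t * r) / (1 - t * r) > 0" "(1 + s) / (1 - s) > 0"
    using tr tr0 r trr unfolding p by simp_all
  ultimately have "ln ((1 + t * r) / (1 - t * r)) + ln ((1 + s) / (1 - s)) = ln ((1 + r) / (1 - r))"
    by (metis ln_mult_pos)
  then show ?thesis unfolding 1 2 s_def[symmetric] by (simp add: artanh_def)
qed

text \<open>The geodesic from \<open>a\<close> to \<open>b\<close> is the image of a radius under the Moebius automorphism
  carrying \<open>0\<close> to \<open>a\<close>.  Only its connectedness and the additivity of distances along it are recorded,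
  since these suffice to cut a disc of a chain at a prescribed crossing.\<close>

lemma poincare_geodesic:
  assumes a: "a \<in> ball 0 1" and b: "b \<in> ball 0 1"
  obtains \<Gamma> where "connected \<Gamma>" "\<Gamma> \<subseteq> ball 0 1" "a \<in> \<Gamma>" "b \<in> \<Gamma>"
    "\<And>c. c \<in> \<Gamma> \<Longrightarrow> poincare_dist a c + poincare_dist c b = poincare_dist a b"
proof -
  let ?S = "Moebius_function 0 a" and ?T = "Moebius_function 0 (- a)"
  have a1: "cmod a < 1" "cmod (- a) < 1" and b1: "cmod b < 1" using a b by auto
  define b' where "b' = ?S b"
  have b': "cmod b' < 1" unfolding b'_def using a1 b1 by (intro Moebius_function_norm_lt_1)
  have Ta: "?T 0 = a" by (simp add: Moebius_function_of_zero)
  have Tb: "?T b' = b" unfolding b'_def using Moebius_function_compose[of "- a" a b] a1 b1 by simp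
  have sub: "closed_segment 0 b' \<subseteq> ball 0 1"
    using b' by (intro closed_segment_subset) auto
  let ?G = "?T ` closed_segment 0 b'"
  have cont: "continuous_on (ball 0 1) ?T"
    using a1 by (intro holomorphic_on_imp_continuous_on Moebius_function_holomorphic) auto
  show thesis
  proof
    show "connected ?G"
      using cont sub by (intro connected_continuous_image continuous_on_subset[OF cont]) auto
    show "?G \<subseteq> ball 0 1"
      using subsetD[OF sub] a1(2) Moebius_function_norm_lt_1[OF a1(2)] by (simp add: image_subset_iff)
    show "a \<in> ?G" using Ta by (metis ends_in_segment(1) image_eqI)
    show "b \<in> ?G" using Tb by (metis ends_in_segment(2) image_eqI)
    fix c assume "c \<in> ?G"
    then obtain t where t: "0 \<le> t" "t \<le> 1" and c: "c = ?T (t *\<^sub>R b')"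
      by (auto simp: in_segment)
    have tb: "cmod (t *\<^sub>R b') < 1"
      using t b' mult_right_mono[of t 1 "cmod b'"] by simp
    have "poincare_dist a c = poincare_dist 0 (t *\<^sub>R b')"
         "poincare_dist c b = poincare_dist (t *\<^sub>R b') b'"
         "poincare_dist a b = poincare_dist 0 b'"
      using poincare_dist_Moebius_invariant[of "- a" 0 "t *\<^sub>R b'"]
        poincare_dist_Moebius_invariant[of "- a" "t *\<^sub>R b'" b']
        poincare_dist_Moebius_invariant[of "- a" 0 b'] a1 b' tb
      unfolding c Ta Tb by simp_all
    then show "poincare_dist a c + poincare_dist c b = poincare_dist a b"
      using poincare_dist_radius_additive[OF b' t] by simp
  qed
qed

section \<open>The Kobayashi distance as a length distance\<close>

definition disc_link ::
  "('a::topological_space, 'n::finite) chart set \<Rightarrow> 'a set \<Rightarrow> 'a \<Rightarrow> 'a \<Rightarrow> real \<Rightarrow> bool" where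
  "disc_link A \<Omega> u v l \<longleftrightarrow>
     (\<exists>f a b. holomorphic_disc A \<Omega> f \<and> a \<in> ball 0 1 \<and> b \<in> ball 0 1 \<and> f a = u \<and> f b = v \<and>
        l = poincare_dist a b)"

inductive disc_chain ::
  "('a::topological_space, 'n::finite) chart set \<Rightarrow> 'a set \<Rightarrow> 'a \<Rightarrow> 'a \<Rightarrow> real \<Rightarrow> bool"
  for A \<Omega> z where
  refl: "disc_chain A \<Omega> z z 0"
| step: "disc_chain A \<Omega> z u l \<Longrightarrow> disc_link A \<Omega> u w l' \<Longrightarrow> disc_chain A \<Omega> z w (l + l')"

lemma disc_link_nonneg: "disc_link A \<Omega> u v l \<Longrightarrow> l \<ge> 0"
  unfolding disc_link_def by (auto intro: poincare_dist_nonneg simp del: mem_ball mem_ball_0)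

lemma disc_link_sym: "disc_link A \<Omega> u v l \<Longrightarrow> disc_link A \<Omega> v u l"
  unfolding disc_link_def by (metis poincare_dist_commute)

lemma disc_link_in_domain: "disc_link A \<Omega> u v l \<Longrightarrow> u \<in> \<Omega> \<and> v \<in> \<Omega>"
  unfolding disc_link_def holomorphic_disc_def by blast

lemma disc_chain_nonneg: "disc_chain A \<Omega> z w l \<Longrightarrow> l \<ge> 0"
  by (induction rule: disc_chain.induct) (auto dest: disc_link_nonneg)

text \<open>The inductive chains replace the indexed families in the definition of the distance, so that
  properties of chains can be proved by rule induction, one disc at a time.\<close>

lemma kobayashi_eq_Inf_disc_chain:
  assumes "z \<in> \<Omega>" "w \<in> \<Omega>"
  shows "kobayashi A \<Omega> z w = Inf {l. disc_chain A \<Omega> z w l}"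
proof -
  let ?S = "{(\<Sum>j<m. poincare_dist (a j) (b j)) | (m::nat) f a b \<zeta>.
             \<zeta> 0 = z \<and> \<zeta> m = w \<and>
             (\<forall>j<m. holomorphic_disc A \<Omega> (f j) \<and> a j \<in> ball 0 1 \<and> b j \<in> ball 0 1 \<and>
                    f j (a j) = \<zeta> j \<and> f j (b j) = \<zeta> (Suc j))}"
  have "disc_chain A \<Omega> (\<zeta> 0) (\<zeta> m) (\<Sum>j<m. poincare_dist (a j) (b j))"
    if "\<forall>j<m. holomorphic_disc A \<Omega> (f j) \<and> a j \<in> ball 0 1 \<and> b j \<in> ball 0 1 \<and>
              f j (a j) = \<zeta> j \<and> f j (b j) = \<zeta> (Suc j)" for m f a b \<zeta>
    using that
  proof (induction m)
    case 0
    then show ?case by (simp add: disc_chain.refl)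
  next
    case (Suc m)
    have "disc_link A \<Omega> (\<zeta> m) (\<zeta> (Suc m)) (poincare_dist (a m) (b m))"
      unfolding disc_link_def using Suc.prems lessI by blast
    moreover have "disc_chain A \<Omega> (\<zeta> 0) (\<zeta> m) (\<Sum>j<m. poincare_dist (a j) (b j))"
      using Suc.prems by (intro Suc.IH) (meson less_SucI)
    ultimately show ?case by (simp add: disc_chain.step)
  qed
  then have "?S \<subseteq> {l. disc_chain A \<Omega> z w l}" by auto
  moreover have "\<exists>(m::nat) f a b \<zeta>. l = (\<Sum>j<m. poincare_dist (a j) (b j)) \<and> \<zeta> 0 = z \<and> \<zeta> m = w \<and>
             (\<forall>j<m. holomorphic_disc A \<Omega> (f j) \<and> a j \<in> ball 0 1 \<and> b j \<in> ball 0 1 \<and>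
                    f j (a j) = \<zeta> j \<and> f j (b j) = \<zeta> (Suc j))"
    if "disc_chain A \<Omega> z w l" for l
    using that
  proof (induction rule: disc_chain.induct)
    case refl
    show ?case by (rule exI[of _ 0]) auto
  next
    case (step u l w l')
    obtain m :: nat and f a b \<zeta> where IH: "l = (\<Sum>j<m. poincare_dist (a j) (b j))" "\<zeta> 0 = z" "\<zeta> m = u"
      "\<forall>j<m. holomorphic_disc A \<Omega> (f j) \<and> a j \<in> ball 0 1 \<and> b j \<in> ball 0 1 \<and>
             f j (a j) = \<zeta> j \<and> f j (b j) = \<zeta> (Suc j)"
      using step.IH by blast
    obtain g c d where g: "holomorphic_disc A \<Omega> g" "c \<in> ball 0 1" "d \<in> ball 0 1" "g c = u" "g d = w"
      "l' = poincare_dist c d"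
      using step.hyps(2) unfolding disc_link_def by blast
    show ?case
    proof (intro exI conjI)
      show "l + l' = (\<Sum>j<Suc m. poincare_dist ((a(m := c)) j) ((b(m := d)) j))"
        using IH(1) g(6) by simp
      show "(\<zeta>(Suc m := w)) 0 = z" "(\<zeta>(Suc m := w)) (Suc m) = w" using IH by simp_all
      show "\<forall>j<Suc m. holomorphic_disc A \<Omega> ((f(m := g)) j) \<and> (a(m := c)) j \<in> ball 0 1 \<and>
              (b(m := d)) j \<in> ball 0 1 \<and> (f(m := g)) j ((a(m := c)) j) = (\<zeta>(Suc m := w)) j \<and>
              (f(m := g)) j ((b(m := d)) j) = (\<zeta>(Suc m := w)) (Suc j)"
        using IH(3,4) g by (auto simp: less_Suc_eq)
    qed
  qed
  then have "{l. disc_chain A \<Omega> z w l} \<subseteq> ?S" by blast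
  ultimately have "?S = {l. disc_chain A \<Omega> z w l}" by (rule subset_antisym)
  then show ?thesis using assms unfolding kobayashi_def by (simp only: if_True simp_thms)
qed

lemma kobayashi_le_disc_chain:
  assumes "z \<in> \<Omega>" "w \<in> \<Omega>" "disc_chain A \<Omega> z w l"
  shows "kobayashi A \<Omega> z w \<le> l"
  unfolding kobayashi_eq_Inf_disc_chain[OF assms(1,2)]
  by (rule cInf_lower) (use assms(3) in \<open>auto intro!: bdd_belowI[of _ 0] disc_chain_nonneg\<close>)

lemma kobayashi_le_disc_link:
  assumes "disc_link A \<Omega> z w l"
  shows "kobayashi A \<Omega> z w \<le> l"
  using kobayashi_le_disc_chain[of z \<Omega> w A l] disc_link_in_domain[OF assms]
    disc_chain.step[OF disc_chain.refl assms] by simp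

lemma chart_ball:
  assumes "complex_manifold A" "open \<Omega>" "q \<in> \<Omega>"
  obtains U \<phi> r where "(U, \<phi>) \<in> A" "open U" "q \<in> U" "r > 0" "homeomorphism U (\<phi> ` U) \<phi> (inv_into U \<phi>)"
    "cball (\<phi> q) r \<subseteq> \<phi> ` U" "inv_into U \<phi> ` cball (\<phi> q) r \<subseteq> \<Omega>"
proof -
  obtain U \<phi> where U: "(U, \<phi>) \<in> A" "q \<in> U"
    using assms(1) unfolding complex_manifold_def by blast
  then have op: "open U" "open (\<phi> ` U)" and hom: "homeomorphism U (\<phi> ` U) \<phi> (inv_into U \<phi>)"
    using assms(1) unfolding complex_manifold_def by auto
  have "open (\<phi> ` U \<inter> inv_into U \<phi> -` \<Omega>)"
    using hom op assms(2) by (intro continuous_open_preimage) (auto simp: homeomorphism_def)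
  moreover have "\<phi> q \<in> \<phi> ` U \<inter> inv_into U \<phi> -` \<Omega>"
    using hom U assms(3) by (auto simp: homeomorphism_def)
  ultimately obtain r where "r > 0" "cball (\<phi> q) r \<subseteq> \<phi> ` U \<inter> inv_into U \<phi> -` \<Omega>"
    using open_contains_cball by blast
  then show thesis using that[of U \<phi> r] U op hom by blast
qed

lemma manifold_compact_neighbourhood:
  fixes A :: "('a::{t2_space, second_countable_topology}, 'n::finite) chart set" and q :: 'a
  assumes "complex_manifold A" "open \<Omega>" "q \<in> \<Omega>"
  obtains B D where "open B" "compact D" "q \<in> B" "B \<subseteq> D" "D \<subseteq> \<Omega>"
proof -
  obtain U \<phi> r where "(U, \<phi>) \<in> A" and U: "open U" "q \<in> U" "r > 0" and hom: "homeomorphism U (\<phi> ` U) \<phi> (inv_into U \<phi>)"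
    and r: "cball (\<phi> q) r \<subseteq> \<phi> ` U" "inv_into U \<phi> ` cball (\<phi> q) r \<subseteq> \<Omega>"
    using chart_ball[OF assms] .
  let ?B = "U \<inter> \<phi> -` ball (\<phi> q) r" and ?D = "inv_into U \<phi> ` cball (\<phi> q) r"
  have "open ?B"
    using hom U by (intro continuous_open_preimage) (auto simp: homeomorphism_def)
  moreover have "compact ?D"
    using hom r(1) by (intro compact_continuous_image compact_cball)
      (auto simp: homeomorphism_def intro: continuous_on_subset)
  moreover have "q \<in> ?B" using U by simp
  moreover have "?B \<subseteq> ?D"
  proof
    fix w assume "w \<in> ?B"
    then have "w = inv_into U \<phi> (\<phi> w)" "\<phi> w \<in> cball (\<phi> q) r"
      using hom by (auto simp: homeomorphism_def)
    then show "w \<in> ?D" by blast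
  qed
  ultimately show thesis using that r(2) by blast
qed

lemma norm_complex_vector_scale: "norm (c *s v) = cmod c * norm (v :: complex^'n)"
  by (simp add: norm_vec_def L2_set_right_distrib norm_mult)

text \<open>The disc is affine in the chart: it runs through \<open>\<phi> q\<close> at \<open>0\<close> in the direction
  of \<open>\<phi> w\<close> and fills the ball of radius \<open>r\<close>, so that \<open>w\<close> is reached at the parameter
  \<open>norm (\<phi> w - \<phi> q) / r\<close>.\<close>

lemma chart_disc_link:
  assumes man: "complex_manifold A" and U: "(U, \<phi>) \<in> A" "q \<in> U" and "r > 0"
    and hom: "homeomorphism U (\<phi> ` U) \<phi> (inv_into U \<phi>)"
    and ball: "ball (\<phi> q) r \<subseteq> \<phi> ` U" "inv_into U \<phi> ` ball (\<phi> q) r \<subseteq> \<Omega>"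
    and w: "w \<in> U" "\<phi> w \<in> ball (\<phi> q) r"
  shows "disc_link A \<Omega> q w (artanh (norm (\<phi> w - \<phi> q) / r))"
proof -
  define \<rho> where "\<rho> = norm (\<phi> w - \<phi> q)"
  \<comment> \<open>For \<open>w = q\<close> division by zero gives \<open>v = 0\<close>, and the disc is constant.\<close>
  define v where "v = (r / \<rho>) *\<^sub>R (\<phi> w - \<phi> q)"
  define L where "L z = \<phi> q + z *s v" for z :: complex
  define f where "f z = inv_into U \<phi> (L z)" for z
  have \<rho>: "0 \<le> \<rho>" "\<rho> < r" using w(2) by (auto simp: \<rho>_def dist_norm norm_minus_commute)
  have inv1: "inv_into U \<phi> (\<phi> u) = u" if "u \<in> U" for u
    using hom that by (auto simp: homeomorphism_def)
  have inv2: "inv_into U \<phi> y \<in> U" "\<phi> (inv_into U \<phi> y) = y" if "y \<in> \<phi> ` U" for y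
    using that by (auto intro: inv_into_into f_inv_into_f)
  have nv: "norm v \<le> r" using \<open>r > 0\<close> by (simp add: v_def \<rho>_def)
  have L: "L z \<in> ball (\<phi> q) r" if "z \<in> ball 0 1" for z
  proof -
    have "cmod z * norm v \<le> cmod z * r" using nv by (intro mult_left_mono) auto
    also have "\<dots> < r" using that \<open>r > 0\<close> by simp
    finally show ?thesis
      by (simp add: L_def dist_norm norm_complex_vector_scale)
  qed
  have bl: "bounded_linear (\<lambda>z. z *s v)"
    by (rule bounded_linear_intro[where K = "norm v"])
       (auto simp: vec_eq_iff algebra_simps norm_complex_vector_scale)
  have dL: "(L has_derivative (\<lambda>h. h *s v)) (at z)" for z
    unfolding L_def using has_derivative_add[OF has_derivative_const bounded_linear_imp_has_derivative[OF bl]]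
    by simp
  have contL: "continuous_on S L" for S
    by (intro continuous_at_imp_continuous_on ballI has_derivative_continuous[OF dL])
  have "holomorphic_disc A \<Omega> f"
    unfolding holomorphic_disc_def
  proof (intro conjI ballI)
    show "f ` ball 0 1 \<subseteq> \<Omega>" using L ball(2) by (auto simp: f_def simp del: mem_ball mem_ball_0)
    show "continuous_on (ball 0 1) f"
      unfolding f_def
    proof (rule continuous_on_compose2[OF _ contL])
      show "continuous_on (ball (\<phi> q) r) (inv_into U \<phi>)"
        using hom ball(1) by (auto simp: homeomorphism_def intro: continuous_on_subset)
      show "L ` ball 0 1 \<subseteq> ball (\<phi> q) r" using L by blast
    qed
    fix V\<psi> assume "V\<psi> \<in> A"
    then obtain V \<psi> where V: "V\<psi> = (V, \<psi>)" "(V, \<psi>) \<in> A" by (cases V\<psi>) auto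
    have hol: "holomorphic_vec_on (\<psi> \<circ> inv_into U \<phi>) (\<phi> ` (U \<inter> V))"
      using man U(1) V(2) unfolding complex_manifold_def by blast
    have "(\<lambda>z. \<psi> (f z) $ i) holomorphic_on {z \<in> ball 0 1. f z \<in> V}" for i
      unfolding holomorphic_on_def
    proof
      fix z assume z: "z \<in> {z \<in> ball 0 1. f z \<in> V}"
      have "L z \<in> \<phi> ` U" using L z ball(1) by blast
      then have "L z \<in> \<phi> ` (U \<inter> V)" 
        using z inv2[of "L z"] imageI[of "f z" "U \<inter> V" \<phi>] unfolding f_def by simp
      then obtain D where D: "((\<psi> \<circ> inv_into U \<phi>) has_derivative D) (at (L z))"
        and lin: "\<And>c u. D (c *s u) = c *s D u"
        using hol unfolding holomorphic_vec_on_def by blast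
      have "((\<psi> \<circ> inv_into U \<phi> \<circ> L) has_derivative (D \<circ> (\<lambda>h. h *s v))) (at z)"
        by (rule diff_chain_at[OF dL D])
      then have "((\<lambda>z. \<psi> (f z) $ i) has_derivative (\<lambda>h. (D v $ i) * h)) (at z)"
        using bounded_linear.has_derivative[OF bounded_linear_vec_nth, of _ _ _ i]
        by (force simp: o_def f_def lin mult.commute)
      then have "((\<lambda>z. \<psi> (f z) $ i) has_field_derivative (D v $ i)) (at z)"
        by (simp add: has_field_derivative_def)
      then show "(\<lambda>z. \<psi> (f z) $ i) field_differentiable (at z within {z \<in> ball 0 1. f z \<in> V})"
        using field_differentiable_at_within field_differentiable_def by blast
    qed
    then show "case V\<psi> of (U, \<phi>) \<Rightarrow> \<forall>i. (\<lambda>z. \<phi> (f z) $ i) holomorphic_on {z \<in> ball 0 1. f z \<in> U}"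
      by (simp add: V(1))
  qed
  moreover have "f 0 = q" using inv1 U by (simp add: f_def L_def)
  moreover have "f (of_real (\<rho> / r)) = w"
  proof -
    have "(of_real (\<rho> / r) :: complex) *s v = (\<rho> / r) *\<^sub>R v"
      by (simp add: vec_eq_iff) (simp add: scaleR_conv_of_real)
    also have "\<dots> = \<phi> w - \<phi> q" using \<open>r > 0\<close> by (auto simp: v_def \<rho>_def)
    finally show ?thesis using inv1 w by (simp add: f_def L_def)
  qed
  moreover have "complex_of_real (\<rho> / r) \<in> ball 0 1" using \<rho> by (simp add: norm_divide)
  moreover have "artanh (\<rho> / r) = poincare_dist 0 (of_real (\<rho> / r))"
    using \<rho> \<open>r > 0\<close> by (simp add: poincare_dist_def norm_divide)
  moreover have "(0::complex) \<in> ball 0 1" by simp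
  ultimately show ?thesis unfolding disc_link_def \<rho>_def[symmetric] by metis
qed

lemma disc_link_locally_short:
  assumes "complex_manifold A" "open \<Omega>" "q \<in> \<Omega>" "\<epsilon> > 0"
  obtains N where "open N" "q \<in> N" "N \<subseteq> \<Omega>"
    "\<forall>w\<in>N. \<exists>l<\<epsilon>. disc_link A \<Omega> q w l"
proof -
  obtain U \<phi> r where U: "(U, \<phi>) \<in> A" "open U" "q \<in> U" "r > 0"
    and hom: "homeomorphism U (\<phi> ` U) \<phi> (inv_into U \<phi>)"
    and r: "cball (\<phi> q) r \<subseteq> \<phi> ` U" "inv_into U \<phi> ` cball (\<phi> q) r \<subseteq> \<Omega>"
    using chart_ball[OF assms(1-3)] .
  have "isCont artanh (0::real)" by (intro isCont_artanh) auto
  then obtain \<delta> where \<delta>: "\<delta> > 0" "\<And>t::real. \<bar>t\<bar> < \<delta> \<Longrightarrow> \<bar>artanh t\<bar> < \<epsilon>"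
    using \<open>\<epsilon> > 0\<close> unfolding continuous_at_eps_delta
    by (metis artanh_0 diff_zero dist_real_def)
  define s where "s = min 1 \<delta> * r"
  have s: "s > 0" "s \<le> r" "s \<le> \<delta> * r" using \<delta>(1) U(4) by (auto simp: s_def min_mult_distrib_right)
  let ?N = "U \<inter> \<phi> -` ball (\<phi> q) s"
  show thesis
  proof
    show "open ?N"
      using hom U by (intro continuous_open_preimage) (auto simp: homeomorphism_def)
    show "q \<in> ?N" using U s by simp
    have link: "\<exists>l<\<epsilon>. disc_link A \<Omega> q w l" if w: "w \<in> ?N" for w
    proof -
      have "norm (\<phi> w - \<phi> q) < s" using w by (simp add: dist_norm norm_minus_commute)
      then have "norm (\<phi> w - \<phi> q) < \<delta> * r" "norm (\<phi> w - \<phi> q) < r" using s by linarith+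
      then have "norm (\<phi> w - \<phi> q) / r < \<delta>" "\<phi> w \<in> ball (\<phi> q) r"
        using U(4) by (auto simp: field_simps dist_norm norm_minus_commute)
      moreover from this have "artanh (norm (\<phi> w - \<phi> q) / r) < \<epsilon>"
        using \<delta>(2)[of "norm (\<phi> w - \<phi> q) / r"] U(4) by simp
      moreover have "ball (\<phi> q) r \<subseteq> \<phi> ` U" "inv_into U \<phi> ` ball (\<phi> q) r \<subseteq> \<Omega>"
        using r ball_subset_cball by blast+
      ultimately show ?thesis
        using chart_disc_link[OF assms(1) U(1,3,4) hom, of \<Omega> w] w by blast
    qed
    then show "?N \<subseteq> \<Omega>" using disc_link_in_domain by blast
    show "\<forall>w\<in>?N. \<exists>l<\<epsilon>. disc_link A \<Omega> q w l" using link by blast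
  qed
qed

text \<open>The points reachable from \<open>z\<close> form an open and closed subset, because near each point \<open>q\<close>
  any two points are joined by two discs through \<open>q\<close>.\<close>

lemma disc_chain_exists:
  assumes "complex_manifold A" "open \<Omega>" "connected \<Omega>" "z \<in> \<Omega>" "w \<in> \<Omega>"
  shows "\<exists>l. disc_chain A \<Omega> z w l"
  using assms(3,4,5)
proof (rule connected_induction_simple)
  show "\<exists>l. disc_chain A \<Omega> z z l" using disc_chain.refl by blast
  fix q assume "q \<in> \<Omega>"
  obtain N where N: "open N" "q \<in> N" "N \<subseteq> \<Omega>" "\<forall>w\<in>N. \<exists>l<1. disc_link A \<Omega> q w l"
    using disc_link_locally_short[OF assms(1,2) \<open>q \<in> \<Omega>\<close> zero_less_one] .
  have "\<exists>l. disc_chain A \<Omega> z y l" if "x \<in> N" "y \<in> N" "disc_chain A \<Omega> z x l" for x y l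
    using bspec[OF N(4) that(1)] bspec[OF N(4) that(2)] that(3) disc_link_sym disc_chain.step by metis
  then have "\<forall>x\<in>N. \<forall>y\<in>N. (\<exists>l. disc_chain A \<Omega> z x l) \<longrightarrow> (\<exists>l. disc_chain A \<Omega> z y l)" by blast
  moreover have "openin (top_of_set \<Omega>) N" using N(1,3) by (simp add: open_openin_trans assms(2))
  ultimately show "\<exists>T. openin (top_of_set \<Omega>) T \<and> q \<in> T \<and>
      (\<forall>x\<in>T. \<forall>y\<in>T. (\<exists>l. disc_chain A \<Omega> z x l) \<longrightarrow> (\<exists>l. disc_chain A \<Omega> z y l))"
    using N(2) by blast
qed

text \<open>Consider the disc of the chain that leaves \<open>B\<close>.  The image of the Poincare geodesic between its
  two marked points is connected, so it meets the shell \<open>D - B\<close>; cutting the disc at that point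
  costs nothing, by additivity along the geodesic.\<close>

lemma kobayashi_crossing:
  fixes A :: "('a::t2_space, 'n::finite) chart set"
  assumes met: "Metric_space \<Omega> (kobayashi A \<Omega>)"
    and B: "open B" "compact D" "B \<subseteq> D" and q: "q \<in> B" "q \<in> \<Omega>"
    and chain: "disc_chain A \<Omega> q w l" and "w \<notin> B"
  shows "\<exists>s\<in>(D - B) \<inter> \<Omega>. kobayashi A \<Omega> q s + kobayashi A \<Omega> s w \<le> l"
  using chain \<open>w \<notin> B\<close>
proof (induction rule: disc_chain.induct)
  case refl
  then show ?case using q by simp
next
  case (step u l w l')
  interpret Metric_space \<Omega> "kobayashi A \<Omega>" by (rule met)
  have uw: "u \<in> \<Omega>" "w \<in> \<Omega>" using disc_link_in_domain[OF step.hyps(2)] by auto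
  show ?case
  proof (cases "u \<in> B")
    case False
    then obtain s where s: "s \<in> (D - B) \<inter> \<Omega>" "kobayashi A \<Omega> q s + kobayashi A \<Omega> s u \<le> l"
      using step.IH by blast
    have "kobayashi A \<Omega> s w \<le> kobayashi A \<Omega> s u + kobayashi A \<Omega> u w"
      using s uw by (intro triangle) auto
    then show ?thesis using s kobayashi_le_disc_link[OF step.hyps(2)]
      by (intro bexI[of _ s]) auto
  next
    case True
    obtain f a b where f: "holomorphic_disc A \<Omega> f" and ab: "a \<in> ball 0 1" "b \<in> ball 0 1"
      and fab: "f a = u" "f b = w" and l': "l' = poincare_dist a b"
      using step.hyps(2) unfolding disc_link_def by blast
    obtain \<Gamma> where \<Gamma>: "connected \<Gamma>" "\<Gamma> \<subseteq> ball 0 1" "a \<in> \<Gamma>" "b \<in> \<Gamma>"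
      and add: "\<And>c. c \<in> \<Gamma> \<Longrightarrow> poincare_dist a c + poincare_dist c b = poincare_dist a b"
      using poincare_geodesic[OF ab] by metis
    have "connected (f ` \<Gamma>)"
      using f \<Gamma>(1,2) unfolding holomorphic_disc_def
      by (intro connected_continuous_image) (auto intro: continuous_on_subset)
    have "\<exists>c\<in>\<Gamma>. f c \<in> D - B"
    proof (rule ccontr)
      assume "\<not> ?thesis"
      then have "f ` \<Gamma> \<subseteq> B \<union> - D" by blast
      moreover have "open (- D)" using compact_imp_closed[OF B(2)] by (rule open_Compl)
      moreover have "B \<inter> f ` \<Gamma> \<noteq> {}" using True \<Gamma>(3) fab by blast
      moreover have "- D \<inter> f ` \<Gamma> \<noteq> {}"
        using \<open>f ` \<Gamma> \<subseteq> B \<union> - D\<close> \<Gamma>(4) fab step.prems by blast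
      moreover have "B \<inter> - D \<inter> f ` \<Gamma> = {}" using B(3) by blast
      ultimately show False using connectedD[OF \<open>connected (f ` \<Gamma>)\<close> B(1), of "- D"] by blast
    qed
    then obtain c where c: "c \<in> \<Gamma>" "f c \<in> D - B" by blast
    have links: "disc_link A \<Omega> u (f c) (poincare_dist a c)" "disc_link A \<Omega> (f c) w (poincare_dist c b)"
      using f ab fab c(1) \<Gamma>(2) unfolding disc_link_def by blast+
    have fc: "f c \<in> \<Omega>" using disc_link_in_domain[OF links(1)] by simp
    have "kobayashi A \<Omega> q (f c) \<le> kobayashi A \<Omega> q u + kobayashi A \<Omega> u (f c)"
      using q uw fc by (intro triangle)
    moreover have "kobayashi A \<Omega> q u \<le> l"
      using kobayashi_le_disc_chain[OF q(2) uw(1) step.hyps(1)] .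
    ultimately show ?thesis
      using c(2) fc kobayashi_le_disc_link[OF links(1)] kobayashi_le_disc_link[OF links(2)]
        add[OF c(1)] l' by (intro bexI[of _ "f c"]) auto
  qed
qed

text \<open>A chain whose length is close to the infimum makes the crossing point almost metrically between
  \<open>q\<close> and \<open>w\<close>; this is the length property of the Kobayashi distance.\<close>

lemma kobayashi_approximate_crossing:
  fixes A :: "('a::{t2_space, second_countable_topology}, 'n::finite) chart set"
  assumes "complex_manifold A" "open \<Omega>" "connected \<Omega>"
    and met: "Metric_space \<Omega> (kobayashi A \<Omega>)"
    and B: "open B" "compact D" "B \<subseteq> D" and q: "q \<in> B" "q \<in> \<Omega>"
    and w: "w \<in> \<Omega>" "w \<notin> B" and "\<epsilon> > 0"
  shows "\<exists>s\<in>(D - B) \<inter> \<Omega>. kobayashi A \<Omega> q s + kobayashi A \<Omega> s w < kobayashi A \<Omega> q w + \<epsilon>"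
proof -
  have "{l. disc_chain A \<Omega> q w l} \<noteq> {}"
    using disc_chain_exists[OF assms(1-3) q(2) w(1)] by blast
  moreover have "Inf {l. disc_chain A \<Omega> q w l} < kobayashi A \<Omega> q w + \<epsilon>"
    using kobayashi_eq_Inf_disc_chain[OF q(2) w(1), of A] \<open>\<epsilon> > 0\<close> by simp
  ultimately obtain l where "disc_chain A \<Omega> q w l" "l < kobayashi A \<Omega> q w + \<epsilon>"
    using cInf_lessD[of "{l. disc_chain A \<Omega> q w l}"] by blast
  then obtain s where "s \<in> (D - B) \<inter> \<Omega>" "kobayashi A \<Omega> q s + kobayashi A \<Omega> s w \<le> l"
    using kobayashi_crossing[OF met B q _ w(2)] by blast
  then show ?thesis using \<open>l < kobayashi A \<Omega> q w + \<epsilon>\<close> by (intro bexI[of _ s]) linarith+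
qed

lemma kobayashi_small:
  fixes A :: "('a::{t2_space, second_countable_topology}, 'n::finite) chart set"
  assumes "complex_manifold A" "open \<Omega>" "q \<in> \<Omega>" "\<epsilon> > 0"
  shows "\<exists>N. open N \<and> q \<in> N \<and> N \<subseteq> \<Omega> \<and> (\<forall>w\<in>N. kobayashi A \<Omega> q w < \<epsilon>)"
proof -
  obtain N where N: "open N" "q \<in> N" "N \<subseteq> \<Omega>" "\<forall>w\<in>N. \<exists>l<\<epsilon>. disc_link A \<Omega> q w l"
    using disc_link_locally_short[OF assms] .
  then have "\<forall>w\<in>N. kobayashi A \<Omega> q w < \<epsilon>"
    using kobayashi_le_disc_link le_less_trans by blast
  then show ?thesis using N by blast
qed

lemma Metric_space_nonexpansive:
  assumes "Metric_space \<Omega> d" "x \<in> \<Omega>" "y \<in> \<Omega>" "z \<in> \<Omega>"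
  shows "\<bar>d x y - d x z\<bar> \<le> d y z"
proof -
  interpret Metric_space \<Omega> d by (rule assms(1))
  show ?thesis
    using triangle[OF assms(2,3,4)] triangle[OF assms(2,4,3)] commute[of y z] by linarith
qed

lemma kobayashi_continuous_on:
  fixes A :: "('a::{t2_space, second_countable_topology}, 'n::finite) chart set"
  assumes "complex_manifold A" "open \<Omega>" "Metric_space \<Omega> (kobayashi A \<Omega>)" "x \<in> \<Omega>"
  shows "continuous_on \<Omega> (kobayashi A \<Omega> x)"
  by (rule nonexpansive_continuous_on[OF kobayashi_small[OF assms(1,2)] Metric_space_nonexpansive[OF assms(3,4)]])

lemma kobayashi_cont_funs:
  fixes A :: "('a::{t2_space, second_countable_topology}, 'n::finite) chart set"
  assumes "complex_manifold A" "open \<Omega>" "Metric_space \<Omega> (kobayashi A \<Omega>)" "x \<in> \<Omega>"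
  shows "restrict (kobayashi A \<Omega> x) \<Omega> \<in> cont_funs \<Omega>"
  using kobayashi_continuous_on[OF assms] by (simp add: cont_funs_def cong: continuous_on_cong)

section \<open>Approach to the boundary of the end compactification\<close>

lemma exhaustion_mono:
  assumes "compact_exhaustion S K" "i \<le> j"
  shows "K i \<subseteq> K j"
proof -
  have "K n \<subseteq> K (Suc n)" for n
    using assms(1) interior_of_subset unfolding compact_exhaustion_def by (metis subset_trans)
  then show ?thesis using lift_Suc_mono_le[of K] assms(2) by blast
qed

lemma exhaustion_neighbourhood:
  assumes "compact_exhaustion S K" "y \<in> S"
  obtains i U where "open U" "y \<in> U" "U \<inter> S \<subseteq> K i"
proof -
  obtain i where "y \<in> K i" using assms unfolding compact_exhaustion_def by blast
  then have "y \<in> (top_of_set S) interior_of K (Suc i)"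
    using assms(1) unfolding compact_exhaustion_def by blast
  then obtain T where "openin (top_of_set S) T" "y \<in> T" "T \<subseteq> K (Suc i)"
    by (auto simp: interior_of_def)
  then show thesis using that unfolding openin_open by (metis Int_commute Int_iff)
qed

lemma exhaustion_absorbs_compact:
  assumes ex: "compact_exhaustion S K" and C: "compact C" "C \<subseteq> S"
  obtains i where "C \<subseteq> K i"
proof -
  define \<U> where "\<U> = {U. open U \<and> (\<exists>i. U \<inter> S \<subseteq> K i)}"
  have "C \<subseteq> \<Union>\<U>"
  proof
    fix y assume "y \<in> C"
    then obtain i U where "open U" "y \<in> U" "U \<inter> S \<subseteq> K i"
      using exhaustion_neighbourhood[OF ex subsetD[OF C(2)]] by metis
    then show "y \<in> \<Union>\<U>" unfolding \<U>_def by blast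
  qed
  then obtain \<V> where \<V>: "\<V> \<subseteq> \<U>" "finite \<V>" "C \<subseteq> \<Union>\<V>"
    by (rule compactE[OF C(1)]) (auto simp: \<U>_def)
  have "\<forall>U\<in>\<V>. \<exists>i. U \<inter> S \<subseteq> K i" using \<V>(1) unfolding \<U>_def by blast
  from bchoice[OF this] obtain i where i: "\<And>U. U \<in> \<V> \<Longrightarrow> U \<inter> S \<subseteq> K (i U)" by blast
  have "K (i U) \<subseteq> K (Max (i ` \<V>))" if "U \<in> \<V>" for U
    using \<V>(2) that by (intro exhaustion_mono[OF ex]) auto
  then have "C \<subseteq> K (Max (i ` \<V>))" using \<V>(3) i C(2) by blast
  then show thesis using that by blast
qed

lemma end_component: "F \<in> ends \<Omega> K \<Longrightarrow> F j \<in> components (closure \<Omega> - K j)"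
  by (simp add: ends_def)

lemma end_antimono:
  assumes "F \<in> ends \<Omega> K" "i \<le> j"
  shows "F j \<subseteq> F i"
  using lift_Suc_antimono_le[of F] assms by (auto simp: ends_def)

lemma end_nonempty: "F \<in> ends \<Omega> K \<Longrightarrow> F j \<noteq> {}"
  using end_component in_components_nonempty by metis

lemma end_subset: "F \<in> ends \<Omega> K \<Longrightarrow> F j \<subseteq> closure \<Omega> - K j"
  using end_component in_components_subset by metis

lemma openin_end_topology_Inl:
  assumes "openin (top_of_set (closure \<Omega>)) W"
  shows "openin (end_topology \<Omega> K) (Inl ` W)"
proof -
  obtain U where U: "open U" "W = closure \<Omega> \<inter> U" using assms by (auto simp: openin_open)
  have "Inl ` W \<in> end_nbhd_base \<Omega> K (Inl y)" if "y \<in> W" for y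
    using U that by (auto simp: Int_commute)
  then show ?thesis using U by (auto simp: openin_end_topology end_closure_def simp del: end_nbhd_base.simps)
qed

text \<open>The basic sets \<open>end_hat\<close> are not known to be open.  The cylinders below are: the points of the
  closure that they contain form an open set, and each of their ends has its tail inside.\<close>

lemma openin_end_topology_cylinder:
  assumes W: "openin (top_of_set (closure \<Omega>)) W"
    and tail: "\<And>H. H \<in> ends \<Omega> K \<Longrightarrow> H m = G m \<Longrightarrow> \<exists>i. H i \<subseteq> W"
  shows "openin (end_topology \<Omega> K) (Inl ` W \<union> Inr ` {H \<in> ends \<Omega> K. H m = G m})"
    (is "openin _ (?A \<union> ?B)")
  unfolding openin_end_topology
proof (intro conjI ballI)
  have A: "openin (end_topology \<Omega> K) ?A" by (rule openin_end_topology_Inl[OF W])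
  then show "?A \<union> ?B \<subseteq> end_closure \<Omega> K"
    by (auto simp: openin_end_topology end_closure_def)
  fix e assume e: "e \<in> ?A \<union> ?B"
  show "\<exists>N\<in>end_nbhd_base \<Omega> K e. N \<subseteq> ?A \<union> ?B"
  proof (cases "e \<in> ?A")
    case True
    then obtain N where "N \<in> end_nbhd_base \<Omega> K e" "N \<subseteq> ?A"
      using A unfolding openin_end_topology by blast
    then show ?thesis by blast
  next
    case False
    then obtain H where H: "e = Inr H" "H \<in> ends \<Omega> K" "H m = G m" using e by blast
    then obtain i where i: "H i \<subseteq> W" using tail by blast
    have "end_hat \<Omega> K H (max i m) \<subseteq> ?A \<union> ?B"
      using end_antimono[OF H(2), of i "max i m"] i H(3) by (auto simp: end_hat_def)
    then show ?thesis using H(1) by auto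
  qed
qed

lemma openin_end_topology_Diff_compact:
  fixes \<Omega> :: "'a::t2_space set"
  assumes ex: "compact_exhaustion (closure \<Omega>) K" and C: "compact C" "C \<subseteq> closure \<Omega>"
  shows "openin (end_topology \<Omega> K) (end_closure \<Omega> K - Inl ` C)"
  unfolding openin_end_topology
proof (intro conjI ballI)
  fix e assume e: "e \<in> end_closure \<Omega> K - Inl ` C"
  show "\<exists>N\<in>end_nbhd_base \<Omega> K e. N \<subseteq> end_closure \<Omega> K - Inl ` C"
  proof (cases e)
    case (Inl y)
    then have "y \<in> - C" using e by blast
    moreover have "open (- C)" using C(1) compact_imp_closed by blast
    ultimately have "Inl ` (- C \<inter> closure \<Omega>) \<in> end_nbhd_base \<Omega> K e" unfolding Inl by auto
    then show ?thesis by (rule rev_bexI) (auto simp: end_closure_def)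
  next
    case (Inr F)
    then have F: "F \<in> ends \<Omega> K" using e by (auto simp: end_closure_def)
    obtain i where "C \<subseteq> K i" using exhaustion_absorbs_compact[OF ex C] .
    then have "end_hat \<Omega> K F i \<subseteq> end_closure \<Omega> K - Inl ` C"
      using end_subset[OF F, of i] by (auto simp: end_hat_def end_closure_def)
    then show ?thesis unfolding Inr by auto
  qed
qed auto

text \<open>The subsequence comes from sequential compactness; its limit cannot be a point of the closure,
  which has a neighbourhood inside some \<open>K i\<close>.  If the limit is the end \<open>G\<close>, then the terms
  lying outside \<open>G m\<close> form a locally finite set, which may be removed from an open cylinder
  around \<open>G\<close>; so only finitely many terms of the subsequence are of this kind.  The set
  \<open>G m\<close> itself need not be open.\<close>

lemma escaping_sequence_tends_to_end:
  fixes \<Omega> :: "'a::t2_space set"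
  assumes ex: "compact_exhaustion (closure \<Omega>) K"
    and seq: "sequentially_compact_space (end_topology \<Omega> K)"
    and x: "\<And>n::nat. x n \<in> closure \<Omega> - K n"
  obtains r G where "strict_mono r" "G \<in> ends \<Omega> K" "\<And>m. \<forall>\<^sub>F n in sequentially. x (r n) \<in> G m"
proof -
  have "range (Inl \<circ> x) \<subseteq> topspace (end_topology \<Omega> K)"
    using x by (auto simp: end_closure_def)
  then obtain e r where r: "strict_mono r" and lim: "limitin (end_topology \<Omega> K) ((Inl \<circ> x) \<circ> r) e sequentially"
    using seq unfolding sequentially_compact_space_def by metis
  have esc: "x n \<notin> K i" if "i \<le> n" for n i
    using x[of n] exhaustion_mono[OF ex that] by blast
  have e: "e \<in> end_closure \<Omega> K" using limitin_topspace[OF lim] by simp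
  show thesis
  proof (cases e)
    case (Inl y)
    then have "y \<in> closure \<Omega>" using e by (auto simp: end_closure_def)
    then obtain i U where U: "open U" "y \<in> U" "U \<inter> closure \<Omega> \<subseteq> K i"
      using exhaustion_neighbourhood[OF ex] by metis
    have "openin (end_topology \<Omega> K) (Inl ` (closure \<Omega> \<inter> U))"
      using U by (intro openin_end_topology_Inl) auto
    moreover have "e \<in> Inl ` (closure \<Omega> \<inter> U)" using U(2) \<open>y \<in> closure \<Omega>\<close> Inl by blast
    ultimately have "\<forall>\<^sub>F n in sequentially. ((Inl \<circ> x) \<circ> r) n \<in> (Inl ` (closure \<Omega> \<inter> U) :: 'a end_point set)"
      by (rule limitinD[OF lim])
    then have "\<forall>\<^sub>F n in sequentially. x (r n) \<in> K i"
      by (rule eventually_mono) (use U(3) in auto)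
    moreover have "\<forall>\<^sub>F n in sequentially. x (r n) \<notin> K i"
      using eventually_ge_at_top[of i]
      by (rule eventually_mono) (meson esc order_trans r seq_suble)
    ultimately have "\<forall>\<^sub>F n::nat in sequentially. False" by eventually_elim simp
    then show thesis by simp
  next
    case (Inr G)
    then have G: "G \<in> ends \<Omega> K" using e by (auto simp: end_closure_def)
    have "\<forall>\<^sub>F n in sequentially. x (r n) \<in> G m" for m
    proof -
      define D where "D = {x n | n. x n \<notin> G m}"
      define W where "W = closure \<Omega> - K m - D"
      have "openin (top_of_set (closure \<Omega>)) W"
      proof (subst openin_subopen, intro ballI)
        fix y assume y: "y \<in> W"
        then have "y \<in> closure \<Omega>" by (simp add: W_def)
        then obtain i U where U: "open U" "y \<in> U" "U \<inter> closure \<Omega> \<subseteq> K i"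
          using exhaustion_neighbourhood[OF ex] by metis
        \<comment> \<open>Terms with index at least \<open>i\<close> avoid \<open>K i\<close>, so near \<open>y\<close> only these finitely many points of \<open>D\<close> count.\<close>
        define E where "E = D \<inter> x ` {..<i}"
        have "closed (K m)"
          using ex compact_imp_closed unfolding compact_exhaustion_def by blast
        moreover have "closed E"
          unfolding E_def by (intro finite_imp_closed) auto
        ultimately have "open (U - K m - E)" using U(1) by auto
        then have "openin (top_of_set (closure \<Omega>)) (closure \<Omega> \<inter> (U - K m - E))" by auto
        moreover have "y \<in> closure \<Omega> \<inter> (U - K m - E)"
          using y U(2) by (auto simp: W_def E_def)
        moreover have "closure \<Omega> \<inter> (U - K m - E) \<subseteq> W"
        proof
          fix z assume z: "z \<in> closure \<Omega> \<inter> (U - K m - E)"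
          have "z \<notin> D"
          proof
            assume "z \<in> D"
            then obtain n where n: "z = x n" unfolding D_def by blast
            have "z \<in> K i" using z U(3) by blast
            then have "n < i" using esc n by (meson not_le)
            then show False using z n \<open>z \<in> D\<close> by (auto simp: E_def)
          qed
          then show "z \<in> W" using z by (auto simp: W_def)
        qed
        ultimately show "\<exists>T. openin (top_of_set (closure \<Omega>)) T \<and> y \<in> T \<and> T \<subseteq> W" by blast
      qed
      moreover have "G m \<subseteq> W"
        using end_subset[OF G, of m] by (auto simp: W_def D_def)
      ultimately have "openin (end_topology \<Omega> K) (Inl ` W \<union> Inr ` {H \<in> ends \<Omega> K. H m = G m})"
        by (intro openin_end_topology_cylinder) (auto intro: exI[of _ m])
      moreover have "e \<in> Inl ` W \<union> Inr ` {H \<in> ends \<Omega> K. H m = G m}" using G Inr by blast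
      ultimately have "\<forall>\<^sub>F n in sequentially. ((Inl \<circ> x) \<circ> r) n \<in> Inl ` W \<union> Inr ` {H \<in> ends \<Omega> K. H m = G m}"
        by (rule limitinD[OF lim])
      then show ?thesis
        by (rule eventually_mono) (auto simp: W_def D_def)
    qed
    then show thesis using that r G by blast
  qed
qed

text \<open>Otherwise there is an escaping sequence whose terms lie in pairwise different components, whereas a
  subsequence of it must end up in a single one.\<close>

lemma finitely_many_outer_components:
  fixes \<Omega> :: "'a::t2_space set"
  assumes ex: "compact_exhaustion (closure \<Omega>) K"
    and seq: "sequentially_compact_space (end_topology \<Omega> K)"
  shows "\<exists>m. finite {C \<in> components (closure \<Omega> - K j). \<not> C \<subseteq> K m}"
proof (rule ccontr)
  let ?Z = "\<lambda>m. {C \<in> components (closure \<Omega> - K j). \<not> C \<subseteq> K m}"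
  assume "\<not> ?thesis"
  then have inf: "infinite (?Z m)" for m by blast
  let ?P = "\<lambda>f n (C, y). C \<in> ?Z n \<and> y \<in> C - K n \<and> (\<forall>i<n. fst (f i) \<noteq> C)"
  have "\<exists>f. \<forall>n::nat. ?P f n (f n)"
  proof (rule dependent_wellorder_choice)
    fix n and f :: "nat \<Rightarrow> 'a set \<times> 'a"
    have "infinite (?Z n - (fst \<circ> f) ` {..<n})" using inf by (intro Diff_infinite_finite) auto
    then have "?Z n - (fst \<circ> f) ` {..<n} \<noteq> {}" by (rule infinite_imp_nonempty)
    then obtain C where "C \<in> ?Z n - (fst \<circ> f) ` {..<n}"
      unfolding ex_in_conv[symmetric] by (rule exE)
    then have "C \<in> ?Z n" "C \<notin> (fst \<circ> f) ` {..<n}" by simp_all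
    moreover from this obtain y where "y \<in> C - K n" by blast
    ultimately show "\<exists>p. ?P f n p" by (intro exI[of _ "(C, y)"]) auto
  qed auto
  then obtain f where f: "\<And>n::nat. ?P f n (f n)" by blast
  define c x where "c n = fst (f n)" and "x n = snd (f n)" for n
  have c: "c n \<in> components (closure \<Omega> - K j)" "x n \<in> c n" "x n \<notin> K n" and
    neq: "i < n \<Longrightarrow> c i \<noteq> c n" for i n
    using f[of n] by (auto simp: c_def x_def case_prod_unfold)
  have "x n \<in> closure \<Omega> - K n" for n using c[of n] in_components_subset by fastforce
  then obtain r G where r: "strict_mono r" and G: "G \<in> ends \<Omega> K"
    and ev: "\<And>m. \<forall>\<^sub>F n in sequentially. x (r n) \<in> G m"
    using escaping_sequence_tends_to_end[OF ex seq] by metis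
  obtain N where N: "\<And>n. n \<ge> N \<Longrightarrow> x (r n) \<in> G j"
    using ev[of j] unfolding eventually_sequentially by blast
  have "c (r n) = G j" if "n \<ge> N" for n
    using N[OF that] c[of "r n"] components_eq end_component[OF G, of j] by blast
  then have "c (r N) = c (r (Suc N))" by simp
  then show False using neq strict_monoD[OF r lessI[of N]] by blast
qed

text \<open>Components are relatively closed, and outside \<open>K m\<close> only finitely many of them are left, so each is
  the complement of a closed set there.\<close>

lemma end_component_eventually_open:
  fixes \<Omega> :: "'a::t2_space set"
  assumes ex: "compact_exhaustion (closure \<Omega>) K"
    and seq: "sequentially_compact_space (end_topology \<Omega> K)"
    and F: "F \<in> ends \<Omega> K"
  obtains m where "openin (top_of_set (closure \<Omega>)) (F j - K m)"
proof -
  let ?X = "top_of_set (closure \<Omega>)" and ?S = "closure \<Omega> - K j"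
  obtain m0 where m0: "finite {C \<in> components ?S. \<not> C \<subseteq> K m0}"
    using finitely_many_outer_components[OF ex seq] by blast
  define m where "m = max j m0"
  have sub: "K j \<subseteq> K m" "K m0 \<subseteq> K m" using exhaustion_mono[OF ex] by (auto simp: m_def)
  define \<C> where "\<C> = {C \<in> components ?S. \<not> C \<subseteq> K m} - {F j}"
  have fin: "finite \<C>" by (rule finite_subset[OF _ m0]) (use sub in \<open>auto simp: \<C>_def\<close>)
  have cl: "closed (K i)" for i
    using ex compact_imp_closed unfolding compact_exhaustion_def by blast
  have open_minus: "openin ?X (closure \<Omega> - K i)" for i
    using cl[of i] by (metis Diff_eq open_Compl openin_open_Int)
  have "openin (top_of_set ?S) (?S - \<Union>\<C>)"
    using fin by (intro openin_diff[OF openin_subtopology_self] closedin_Union)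
      (auto simp: \<C>_def closedin_component)
  then have "openin ?X (?S - \<Union>\<C>)" using open_minus openin_trans by blast
  then have "openin ?X ((?S - \<Union>\<C>) \<inter> (closure \<Omega> - K m))" using open_minus by blast
  also have "(?S - \<Union>\<C>) \<inter> (closure \<Omega> - K m) = F j - K m"
  proof (intro subset_antisym subsetI)
    fix z assume z: "z \<in> (?S - \<Union>\<C>) \<inter> (closure \<Omega> - K m)"
    then obtain C where "C \<in> components ?S" "z \<in> C" by (metis DiffD1 IntD1 Union_components UnionE)
    then show "z \<in> F j - K m" using z by (auto simp: \<C>_def)
  next
    fix z assume z: "z \<in> F j - K m"
    have "z \<notin> C" if "C \<in> \<C>" for C
    proof -
      have "C \<inter> F j = {}" using that components_nonoverlap[of C ?S "F j"] end_component[OF F] by (auto simp: \<C>_def)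
      then show ?thesis using z by blast
    qed
    then show "z \<in> (?S - \<Union>\<C>) \<inter> (closure \<Omega> - K m)" using z end_subset[OF F, of j] by blast
  qed
  finally show thesis using that by blast
qed

text \<open>A boundary point is not the image of a point of \<open>\<Omega>\<close>, so its neighbourhoods and its punctured
  neighbourhoods have the same trace on \<open>\<Omega>\<close>.\<close>

lemma eventually_within_domain:
  assumes "x \<in> end_boundary \<Omega> K"
  shows "eventually P (within_domain \<Omega> K x) \<longleftrightarrow>
    (\<exists>V. openin (end_topology \<Omega> K) V \<and> x \<in> V \<and> (\<forall>w\<in>\<Omega>. Inl w \<in> V \<longrightarrow> P w))"
proof
  assume "eventually P (within_domain \<Omega> K x)"
  then obtain Q where "eventually Q (atin_within (end_topology \<Omega> K) x (Inl ` \<Omega>))" "\<And>w. Q (Inl w) \<Longrightarrow> P w"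
    unfolding within_domain_def eventually_filtercomap by blast
  moreover have "x \<in> topspace (end_topology \<Omega> K)" "x \<notin> Inl ` \<Omega>"
    using assms by (auto simp: end_boundary_def)
  ultimately obtain V where "openin (end_topology \<Omega> K) V" "x \<in> V"
    "\<forall>e\<in>V. e \<in> Inl ` \<Omega> \<and> e \<noteq> x \<longrightarrow> Q e"
    unfolding eventually_atin_within by blast
  then show "\<exists>V. openin (end_topology \<Omega> K) V \<and> x \<in> V \<and> (\<forall>w\<in>\<Omega>. Inl w \<in> V \<longrightarrow> P w)"
    using \<open>x \<notin> Inl ` \<Omega>\<close> \<open>\<And>w. Q (Inl w) \<Longrightarrow> P w\<close> by (intro exI[of _ V]) auto
next
  assume "\<exists>V. openin (end_topology \<Omega> K) V \<and> x \<in> V \<and> (\<forall>w\<in>\<Omega>. Inl w \<in> V \<longrightarrow> P w)"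
  then obtain V where V: "openin (end_topology \<Omega> K) V" "x \<in> V" "\<And>w. w \<in> \<Omega> \<Longrightarrow> Inl w \<in> V \<Longrightarrow> P w"
    by blast
  have "eventually (\<lambda>e. \<exists>w. e = Inl w \<and> P w) (atin_within (end_topology \<Omega> K) x (Inl ` \<Omega>))"
    unfolding eventually_atin_within using V by blast
  then show "eventually P (within_domain \<Omega> K x)"
    unfolding within_domain_def eventually_filtercomap by blast
qed

lemma limitin_end_boundary_iff_filterlim:
  assumes "x \<in> end_boundary \<Omega> K" and \<sigma>: "range \<sigma> \<subseteq> \<Omega>"
  shows "limitin (end_topology \<Omega> K) (Inl \<circ> \<sigma>) x F \<longleftrightarrow> filterlim \<sigma> (within_domain \<Omega> K x) F"
proof
  assume L: "limitin (end_topology \<Omega> K) (Inl \<circ> \<sigma>) x F"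
  show "filterlim \<sigma> (within_domain \<Omega> K x) F"
    unfolding filterlim_iff
  proof (intro allI impI)
    fix P assume "eventually P (within_domain \<Omega> K x)"
    then obtain V where V: "openin (end_topology \<Omega> K) V" "x \<in> V" "\<forall>w\<in>\<Omega>. Inl w \<in> V \<longrightarrow> P w"
      using eventually_within_domain[OF assms(1)] by blast
    from limitinD[OF L V(1,2)] show "eventually (\<lambda>n. P (\<sigma> n)) F"
      by (rule eventually_mono) (use V(3) \<sigma> in auto)
  qed
next
  assume R: "filterlim \<sigma> (within_domain \<Omega> K x) F"
  have "eventually (\<lambda>n. (Inl \<circ> \<sigma>) n \<in> V) F" if "openin (end_topology \<Omega> K) V" "x \<in> V" for V
  proof -
    have "eventually (\<lambda>w. Inl w \<in> V) (within_domain \<Omega> K x)"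
      using eventually_within_domain[OF assms(1)] that by blast
    then have "\<forall>\<^sub>F n in F. Inl (\<sigma> n) \<in> V" using R unfolding filterlim_iff by blast
    then show ?thesis by simp
  qed
  then show "limitin (end_topology \<Omega> K) (Inl \<circ> \<sigma>) x F"
    using assms(1) by (auto simp: limitin_def end_boundary_def)
qed

lemma eventually_within_domain_Inl:
  assumes "Inl y \<in> end_boundary \<Omega> K"
  shows "eventually P (within_domain \<Omega> K (Inl y)) \<longleftrightarrow> (\<exists>U. open U \<and> y \<in> U \<and> (\<forall>w\<in>U \<inter> \<Omega>. P w))"
proof -
  have y: "y \<in> closure \<Omega>" using assms by (auto simp: end_boundary_def end_closure_def)
  show ?thesis
    unfolding eventually_within_domain[OF assms]
  proof
    assume "\<exists>V. openin (end_topology \<Omega> K) V \<and> Inl y \<in> V \<and> (\<forall>w\<in>\<Omega>. Inl w \<in> V \<longrightarrow> P w)"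
    then obtain V where V: "openin (end_topology \<Omega> K) V" "Inl y \<in> V" "\<forall>w\<in>\<Omega>. Inl w \<in> V \<longrightarrow> P w"
      by blast
    then obtain U where "open U" "y \<in> U" "Inl ` (U \<inter> closure \<Omega>) \<subseteq> V"
      unfolding openin_end_topology by fastforce
    then show "\<exists>U. open U \<and> y \<in> U \<and> (\<forall>w\<in>U \<inter> \<Omega>. P w)"
      using V(3) closure_subset[of \<Omega>] by blast
  next
    assume "\<exists>U. open U \<and> y \<in> U \<and> (\<forall>w\<in>U \<inter> \<Omega>. P w)"
    then obtain U where U: "open U" "y \<in> U" "\<forall>w\<in>U \<inter> \<Omega>. P w" by blast
    have "openin (end_topology \<Omega> K) (Inl ` (closure \<Omega> \<inter> U))"
      using U(1) by (intro openin_end_topology_Inl) auto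
    then show "\<exists>V. openin (end_topology \<Omega> K) V \<and> Inl y \<in> V \<and> (\<forall>w\<in>\<Omega>. Inl w \<in> V \<longrightarrow> P w)"
      using U y by blast
  qed
qed

text \<open>The openness of \<open>F j\<close> outside a compact set is what makes it a neighbourhood of the end.\<close>

lemma eventually_within_domain_Inr:
  fixes \<Omega> :: "'a::t2_space set"
  assumes ex: "compact_exhaustion (closure \<Omega>) K"
    and seq: "sequentially_compact_space (end_topology \<Omega> K)"
    and F: "Inr F \<in> end_boundary \<Omega> K"
  shows "eventually P (within_domain \<Omega> K (Inr F)) \<longleftrightarrow> (\<exists>j. \<forall>w\<in>F j \<inter> \<Omega>. P w)"
proof -
  have FE: "F \<in> ends \<Omega> K" using F by (auto simp: end_boundary_def end_closure_def)
  show ?thesis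
    unfolding eventually_within_domain[OF F]
  proof
    assume "\<exists>V. openin (end_topology \<Omega> K) V \<and> Inr F \<in> V \<and> (\<forall>w\<in>\<Omega>. Inl w \<in> V \<longrightarrow> P w)"
    then obtain V where V: "openin (end_topology \<Omega> K) V" "Inr F \<in> V" "\<forall>w\<in>\<Omega>. Inl w \<in> V \<longrightarrow> P w"
      by blast
    then obtain j where "end_hat \<Omega> K F j \<subseteq> V" unfolding openin_end_topology by force
    then show "\<exists>j. \<forall>w\<in>F j \<inter> \<Omega>. P w" using V(3) by (auto simp: end_hat_def)
  next
    assume "\<exists>j. \<forall>w\<in>F j \<inter> \<Omega>. P w"
    then obtain j where j: "\<forall>w\<in>F j \<inter> \<Omega>. P w" by blast
    obtain m where m: "openin (top_of_set (closure \<Omega>)) (F j - K m)"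
      using end_component_eventually_open[OF ex seq FE] .
    have "H (max j m) \<subseteq> F j - K m" if H: "H \<in> ends \<Omega> K" "H j = F j" for H
    proof -
      have "H (max j m) \<subseteq> H j" "H (max j m) \<subseteq> H m" using end_antimono[OF H(1)] by simp_all
      then show ?thesis using end_subset[OF H(1), of m] H(2) by blast
    qed
    then have "openin (end_topology \<Omega> K) (Inl ` (F j - K m) \<union> Inr ` {H \<in> ends \<Omega> K. H j = F j})"
      by (intro openin_end_topology_cylinder[OF m]) blast
    then show "\<exists>V. openin (end_topology \<Omega> K) V \<and> Inr F \<in> V \<and> (\<forall>w\<in>\<Omega>. Inl w \<in> V \<longrightarrow> P w)"
      using FE j by blast
  qed
qed

text \<open>The base sets are nonempty: near a point of the closure by definition, and at an end because a nonempty
  relatively open part of \<open>F j\<close> meets the dense subset \<open>\<Omega>\<close>.\<close>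

lemma within_domain_countable_base:
  fixes \<Omega> :: "'a::{t2_space, first_countable_topology} set"
  assumes ex: "compact_exhaustion (closure \<Omega>) K"
    and seq: "sequentially_compact_space (end_topology \<Omega> K)"
    and x: "x \<in> end_boundary \<Omega> K"
  obtains B :: "nat \<Rightarrow> 'a set" where "\<And>n. B n \<noteq> {}" "\<And>n. B n \<subseteq> \<Omega>" "decseq B"
    "\<And>P. eventually P (within_domain \<Omega> K x) \<longleftrightarrow> (\<exists>n. \<forall>w\<in>B n. P w)"
proof (cases x)
  case (Inl y)
  have y: "y \<in> closure \<Omega>" using x Inl by (auto simp: end_boundary_def end_closure_def)
  obtain A where A: "\<And>i. open (A i)" "\<And>i. y \<in> A i"
    "\<And>S. open S \<Longrightarrow> y \<in> S \<Longrightarrow> \<forall>\<^sub>F i in sequentially. A i \<subseteq> S"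
    using countable_basis_at_decseq[of y] by metis
  define B where "B n = (\<Inter>i\<le>n. A i) \<inter> \<Omega>" for n :: nat
  have op: "open (\<Inter>i\<le>n. A i)" for n :: nat using A(1) by (intro open_INT) auto
  show thesis
  proof
    show "B n \<noteq> {}" for n
    proof -
      have "y \<in> (\<Inter>i\<le>n. A i)" using A(2) by blast
      then show ?thesis using y op[of n] open_Int_closure_eq_empty[of "\<Inter>i\<le>n. A i" \<Omega>] unfolding B_def by blast
    qed
    show "B n \<subseteq> \<Omega>" for n by (simp add: B_def)
    show "decseq B" unfolding decseq_def B_def by fastforce
    show "eventually P (within_domain \<Omega> K x) \<longleftrightarrow> (\<exists>n. \<forall>w\<in>B n. P w)" for P
      unfolding Inl eventually_within_domain_Inl[OF x[unfolded Inl]]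
    proof
      assume "\<exists>U. open U \<and> y \<in> U \<and> (\<forall>w\<in>U \<inter> \<Omega>. P w)"
      then obtain U where U: "open U" "y \<in> U" "\<forall>w\<in>U \<inter> \<Omega>. P w" by blast
      then obtain n where "A n \<subseteq> U" using A(3) eventually_happens'[OF sequentially_bot] by blast
      then show "\<exists>n. \<forall>w\<in>B n. P w" using U(3) by (intro exI[of _ n]) (auto simp: B_def)
    next
      assume "\<exists>n. \<forall>w\<in>B n. P w"
      then obtain n where "\<forall>w\<in>B n. P w" by blast
      then show "\<exists>U. open U \<and> y \<in> U \<and> (\<forall>w\<in>U \<inter> \<Omega>. P w)"
        using op[of n] A(2) by (intro exI[of _ "\<Inter>i\<le>n. A i"]) (auto simp: B_def)
    qed
  qed
next
  case (Inr F)
  have F: "F \<in> ends \<Omega> K" using x Inr by (auto simp: end_boundary_def end_closure_def)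
  show thesis
  proof
    show "F n \<inter> \<Omega> \<noteq> {}" for n
    proof -
      obtain m where "openin (top_of_set (closure \<Omega>)) (F n - K m)"
        using end_component_eventually_open[OF ex seq F] .
      then obtain U where U: "open U" "F n - K m = closure \<Omega> \<inter> U" by (auto simp: openin_open)
      have "F (max n m) \<subseteq> F n - K m"
        using end_antimono[OF F, of n "max n m"] end_antimono[OF F, of m "max n m"] end_subset[OF F, of m] by auto
      then have "closure \<Omega> \<inter> U \<noteq> {}" using end_nonempty[OF F] U(2) by blast
      then have "U \<inter> \<Omega> \<noteq> {}" using open_Int_closure_eq_empty[OF U(1)] by blast
      then show ?thesis using U(2) closure_subset[of \<Omega>] by blast
    qed
    show "F n \<inter> \<Omega> \<subseteq> \<Omega>" for n by blast
    show "decseq (\<lambda>n. F n \<inter> \<Omega>)" using end_antimono[OF F] unfolding decseq_def by blast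
    show "eventually P (within_domain \<Omega> K x) \<longleftrightarrow> (\<exists>n. \<forall>w\<in>F n \<inter> \<Omega>. P w)" for P
      unfolding Inr by (rule eventually_within_domain_Inr[OF ex seq x[unfolded Inr]])
  qed
qed

lemma frequently_within_domain_sequence:
  fixes \<Omega> :: "'a::{t2_space, first_countable_topology} set"
  assumes ex: "compact_exhaustion (closure \<Omega>) K"
    and seq: "sequentially_compact_space (end_topology \<Omega> K)"
    and x: "x \<in> end_boundary \<Omega> K"
    and freq: "\<And>n::nat. \<exists>\<^sub>F w in within_domain \<Omega> K x. P n w"
  obtains \<sigma> where "range \<sigma> \<subseteq> \<Omega>" "\<And>n. P n (\<sigma> n)" "limitin (end_topology \<Omega> K) (Inl \<circ> \<sigma>) x sequentially"
proof (rule within_domain_countable_base[OF ex seq x])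
  fix B :: "nat \<Rightarrow> 'a set"
  assume B: "\<And>n. B n \<noteq> {}" "\<And>n. B n \<subseteq> \<Omega>" "decseq B"
    "\<And>P. eventually P (within_domain \<Omega> K x) \<longleftrightarrow> (\<exists>n. \<forall>w\<in>B n. P w)"
  have "\<exists>w\<in>B n. P n w" for n using freq[of n] unfolding frequently_def B(4) by blast
  then obtain \<sigma> where \<sigma>: "\<And>n. \<sigma> n \<in> B n" "\<And>n. P n (\<sigma> n)" by metis
  have "range \<sigma> \<subseteq> \<Omega>" using \<sigma>(1) B(2) by blast
  moreover have "filterlim \<sigma> (within_domain \<Omega> K x) sequentially"
    unfolding filterlim_iff
  proof (intro allI impI)
    fix Q assume "eventually Q (within_domain \<Omega> K x)"
    then obtain N where N: "\<forall>w\<in>B N. Q w" using B(4) by auto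
    have "Q (\<sigma> n)" if "n \<ge> N" for n using N \<sigma>(1)[of n] decseqD[OF B(3) that] by (simp add: subset_eq)
    then show "\<forall>\<^sub>F n in sequentially. Q (\<sigma> n)" unfolding eventually_sequentially by (intro exI[of _ N]) simp
  qed
  ultimately show thesis
    using that \<sigma>(2) limitin_end_boundary_iff_filterlim[OF x] by blast
qed

lemma within_domain_nontrivial:
  fixes \<Omega> :: "'a::{t2_space, first_countable_topology} set"
  assumes ex: "compact_exhaustion (closure \<Omega>) K"
    and seq: "sequentially_compact_space (end_topology \<Omega> K)"
    and x: "x \<in> end_boundary \<Omega> K"
  shows "within_domain \<Omega> K x \<noteq> bot"
proof (rule within_domain_countable_base[OF ex seq x])
  fix B :: "nat \<Rightarrow> 'a set"
  assume B: "\<And>n. B n \<noteq> {}" "\<And>n. B n \<subseteq> \<Omega>" "decseq B"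
    "\<And>P. eventually P (within_domain \<Omega> K x) \<longleftrightarrow> (\<exists>n. \<forall>w\<in>B n. P w)"
  then have "\<not> eventually (\<lambda>w. False) (within_domain \<Omega> K x)" by auto
  then show ?thesis by auto
qed

lemma limitin_end_boundary_leaves_compact:
  fixes \<Omega> :: "'a::t2_space set"
  assumes ex: "compact_exhaustion (closure \<Omega>) K" and x: "x \<in> end_boundary \<Omega> K"
    and lim: "limitin (end_topology \<Omega> K) (Inl \<circ> \<sigma>) x F" and C: "compact C" "C \<subseteq> \<Omega>"
  shows "\<forall>\<^sub>F n in F. \<sigma> n \<notin> C"
proof -
  have "openin (end_topology \<Omega> K) (end_closure \<Omega> K - Inl ` C)"
    using ex C closure_subset by (intro openin_end_topology_Diff_compact) blast+
  moreover have "x \<in> end_closure \<Omega> K - Inl ` C" using x C(2) by (auto simp: end_boundary_def)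
  ultimately have "\<forall>\<^sub>F n in F. (Inl \<circ> \<sigma>) n \<in> end_closure \<Omega> K - Inl ` C"
    by (rule limitinD[OF lim])
  then show ?thesis by (rule eventually_mono) auto
qed

section \<open>Horofunctions at the boundary\<close>

text \<open>Suppose that the limit \<open>h\<close> is \<open>k q\<close> up to a constant.  Take a shell \<open>D - B\<close> around \<open>q\<close>, on
  which \<open>k q \<ge> \<delta> > 0\<close>.  For large \<open>n\<close> the chain from \<open>q\<close> to \<open>\<sigma> n\<close> crosses it at some \<open>s\<close> with
  \<open>k (\<sigma> n) s - k (\<sigma> n) q < \<delta> / 2 - k q s\<close>, while uniform convergence on \<open>D\<close> makes the left-hand
  side larger than \<open>k q s - \<delta> / 2\<close>.  Together these give \<open>k q s < \<delta> / 2\<close>.\<close>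

lemma escaping_limit_not_embedded:
  fixes A :: "('a::{t2_space, second_countable_topology}, 'n::finite) chart set"
  assumes man: "complex_manifold A" and op: "open \<Omega>" and "connected \<Omega>"
    and met: "Metric_space \<Omega> (kobayashi A \<Omega>)" and p: "p \<in> \<Omega>" and q: "q \<in> \<Omega>"
    and \<sigma>: "\<And>n. \<sigma> n \<in> \<Omega>" and esc: "\<And>C. compact C \<Longrightarrow> C \<subseteq> \<Omega> \<Longrightarrow> \<forall>\<^sub>F n in sequentially. \<sigma> n \<notin> C"
    and lim: "\<And>C. compact C \<Longrightarrow> C \<subseteq> \<Omega> \<Longrightarrow>
      uniform_limit C (\<lambda>n y. kobayashi A \<Omega> (\<sigma> n) y - kobayashi A \<Omega> (\<sigma> n) p) h sequentially"
  shows "\<not> (\<forall>y\<in>\<Omega>. h y = kobayashi A \<Omega> q y + c)"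
proof
  let ?k = "kobayashi A \<Omega>"
  interpret Metric_space \<Omega> ?k by (rule met)
  assume h: "\<forall>y\<in>\<Omega>. h y = ?k q y + c"
  obtain B D where B: "open B" "compact D" "q \<in> B" "B \<subseteq> D" "D \<subseteq> \<Omega>"
    using manifold_compact_neighbourhood[OF man op q] .
  let ?S = "D - B"
  obtain \<delta> where \<delta>: "\<delta> > 0" "\<forall>s\<in>?S. \<delta> \<le> ?k q s"
  proof (cases "?S = {}")
    case True
    then show thesis using that[of 1] by auto
  next
    case False
    have "continuous_on ?S (?k q)"
      using kobayashi_continuous_on[OF man op met q] B(5) by (auto intro: continuous_on_subset)
    then obtain s0 where s0: "s0 \<in> ?S" "\<forall>s\<in>?S. ?k q s0 \<le> ?k q s"
      using continuous_attains_inf[OF compact_diff[OF B(2,1)] False] by blast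
    have "?k q s0 \<noteq> 0" using s0(1) B(3,5) q by (subst zero) auto
    then have "?k q s0 > 0" using nonneg[of q s0] by linarith
    then show thesis using that s0(2) by blast
  qed
  have "\<forall>\<^sub>F n in sequentially. \<forall>y\<in>D. dist (?k (\<sigma> n) y - ?k (\<sigma> n) p) (h y) < \<delta> / 4"
    using uniform_limitD[OF lim[OF B(2,5)], of "\<delta> / 4"] \<delta>(1) by simp
  moreover have "\<forall>\<^sub>F n in sequentially. \<sigma> n \<notin> D" by (rule esc[OF B(2,5)])
  ultimately have "\<forall>\<^sub>F n in sequentially. (\<forall>y\<in>D. dist (?k (\<sigma> n) y - ?k (\<sigma> n) p) (h y) < \<delta> / 4) \<and> \<sigma> n \<notin> D"
    by (rule eventually_conj)
  then obtain n where n: "\<forall>y\<in>D. dist (?k (\<sigma> n) y - ?k (\<sigma> n) p) (h y) < \<delta> / 4" "\<sigma> n \<notin> D"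
    using eventually_happens'[OF sequentially_bot] by blast
  have "\<sigma> n \<notin> B" using n(2) B(4) by blast
  then obtain s where s: "s \<in> ?S" "?k q s + ?k s (\<sigma> n) < ?k q (\<sigma> n) + \<delta> / 2"
    using kobayashi_approximate_crossing[OF man op assms(3) met B(1,2,4,3) q \<sigma>, of n "\<delta> / 2"] \<delta>(1)
    by auto
  have "\<bar>?k (\<sigma> n) s - ?k (\<sigma> n) p - h s\<bar> < \<delta> / 4" "\<bar>?k (\<sigma> n) q - ?k (\<sigma> n) p - h q\<bar> < \<delta> / 4"
    using n(1) s(1) B(3,4) unfolding dist_real_def by blast+
  moreover have "h s = ?k q s + c" "h q = c" using h s(1) B(5) q by auto
  moreover have "?k s (\<sigma> n) = ?k (\<sigma> n) s" "?k q (\<sigma> n) = ?k (\<sigma> n) q" by (rule commute)+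
  moreover have "\<delta> \<le> ?k q s" using \<delta>(2) s(1) by blast
  ultimately show False using s(2) \<delta>(1) by linarith
qed

lemma escaping_sequence_subconverges_to_metric_boundary:
  fixes A :: "('a::{t2_space, second_countable_topology}, 'n::finite) chart set"
  assumes man: "complex_manifold A" and dom: "is_domain \<Omega>"
    and met: "Metric_space \<Omega> (kobayashi A \<Omega>)"
    and \<sigma>: "\<And>n. \<sigma> n \<in> \<Omega>" and esc: "\<And>C. compact C \<Longrightarrow> C \<subseteq> \<Omega> \<Longrightarrow> \<forall>\<^sub>F n in sequentially. \<sigma> n \<notin> C"
  obtains r \<xi> where "strict_mono r" "\<xi> \<in> metric_boundary A \<Omega>"
    "limitin (quotient_function_topology \<Omega>) (metric_embedding A \<Omega> \<circ> (\<sigma> \<circ> r)) \<xi> sequentially"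
proof -
  let ?k = "kobayashi A \<Omega>"
  interpret Metric_space \<Omega> ?k by (rule met)
  have op: "open \<Omega>" and conn: "connected \<Omega>" and ne: "\<Omega> \<noteq> {}"
    using dom by (auto simp: is_domain_def)
  obtain p where p: "p \<in> \<Omega>" using ne by blast
  define f where "f n y = ?k (\<sigma> n) y - ?k (\<sigma> n) p" for n y
  have lip: "\<bar>f n y - f n z\<bar> \<le> ?k y z" if "y \<in> \<Omega>" "z \<in> \<Omega>" for n y z
    using Metric_space_nonexpansive[OF met \<sigma> that, of n] by (simp add: f_def)
  have fp: "f n p = 0" for n by (simp add: f_def)
  obtain r h where r: "strict_mono r" and h: "\<forall>y\<in>\<Omega>. \<forall>z\<in>\<Omega>. \<bar>h y - h z\<bar> \<le> ?k y z"
    and lim: "\<forall>C. compact C \<and> C \<subseteq> \<Omega> \<longrightarrow> uniform_limit C (\<lambda>n. f (r n)) h sequentially"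
    using nonexpansive_convergent_subsequence[of \<Omega> ?k f p, OF met op kobayashi_small[OF man op] lip p fp] .
  have cont: "restrict g \<Omega> \<in> cont_funs \<Omega>" if "\<And>y z. y \<in> \<Omega> \<Longrightarrow> z \<in> \<Omega> \<Longrightarrow> \<bar>g y - g z\<bar> \<le> ?k y z" for g
    using nonexpansive_continuous_on[OF kobayashi_small[OF man op] that]
    by (simp add: cont_funs_def cong: continuous_on_cong)
  have hc: "restrict h \<Omega> \<in> cont_funs \<Omega>" using h by (intro cont) blast
  have fc: "restrict (f n) \<Omega> \<in> cont_funs \<Omega>" for n using lip by (intro cont)
  have emb: "metric_embedding A \<Omega> (\<sigma> n) = const_class \<Omega> (restrict (f n) \<Omega>)" for n
    unfolding metric_embedding_def
    using const_class_eq_iff[OF kobayashi_cont_funs[OF man op met \<sigma>] fc]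
    by (auto simp: f_def intro!: exI[of _ "- ?k (\<sigma> n) p"])
  let ?\<xi> = "const_class \<Omega> (restrict h \<Omega>)"
  have "limitin (quotient_function_topology \<Omega>) (\<lambda>n. const_class \<Omega> (restrict (f (r n)) \<Omega>)) ?\<xi> sequentially"
  proof (rule limitin_const_class[OF fc hc])
    fix C assume C: "compact C" "C \<subseteq> \<Omega>"
    then have "uniform_limit C (\<lambda>n. f (r n)) h sequentially" using lim by blast
    then show "uniform_limit C (\<lambda>n. restrict (f (r n)) \<Omega>) (restrict h \<Omega>) sequentially"
      by (rule uniform_limit_cong'[THEN iffD1, rotated -1]) (use C(2) in auto)
  qed
  then have lim\<xi>: "limitin (quotient_function_topology \<Omega>) (metric_embedding A \<Omega> \<circ> (\<sigma> \<circ> r)) ?\<xi> sequentially"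
    by (simp add: emb o_def)
  have "?\<xi> \<in> metric_compactification A \<Omega>"
    unfolding metric_compactification_def in_closure_of
  proof (intro conjI allI impI)
    show "?\<xi> \<in> topspace (quotient_function_topology \<Omega>)" by (rule limitin_topspace[OF lim\<xi>])
    fix T assume "?\<xi> \<in> T \<and> openin (quotient_function_topology \<Omega>) T"
    then have "\<forall>\<^sub>F n in sequentially. (metric_embedding A \<Omega> \<circ> (\<sigma> \<circ> r)) n \<in> T"
      using limitinD[OF lim\<xi>] by blast
    then obtain n where "(metric_embedding A \<Omega> \<circ> (\<sigma> \<circ> r)) n \<in> T"
      using eventually_happens'[OF sequentially_bot] by blast
    then show "\<exists>y. y \<in> metric_embedding A \<Omega> ` \<Omega> \<and> y \<in> T" using \<sigma> by auto
  qed
  moreover have "?\<xi> \<noteq> metric_embedding A \<Omega> q" if q: "q \<in> \<Omega>" for q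
  proof
    assume "?\<xi> = metric_embedding A \<Omega> q"
    then have "metric_embedding A \<Omega> q = ?\<xi>" ..
    then obtain c where "\<forall>y\<in>\<Omega>. h y = ?k q y + c"
      unfolding metric_embedding_def const_class_eq_iff[OF kobayashi_cont_funs[OF man op met q] hc]
      by auto
    moreover have "\<forall>\<^sub>F n in sequentially. \<sigma> (r n) \<notin> C" if "compact C" "C \<subseteq> \<Omega>" for C
      using eventually_subseq[OF r esc[OF that]] .
    moreover have "uniform_limit C (\<lambda>n y. ?k (\<sigma> (r n)) y - ?k (\<sigma> (r n)) p) h sequentially"
      if "compact C" "C \<subseteq> \<Omega>" for C
      using lim that unfolding f_def by blast
    ultimately show False
      using escaping_limit_not_embedded[OF man op conn met p q, of "\<sigma> \<circ> r" h] \<sigma> by auto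
  qed
  ultimately have "?\<xi> \<in> metric_boundary A \<Omega>" by (auto simp: metric_boundary_def)
  then show thesis using that r lim\<xi> by blast
qed

lemma horofunction_as_limit:
  fixes A :: "('a::{t2_space, second_countable_topology}, 'n::finite) chart set"
  assumes man: "complex_manifold A" and op: "open \<Omega>"
    and met: "Metric_space \<Omega> (kobayashi A \<Omega>)" and p: "p \<in> \<Omega>" and z: "z \<in> \<Omega>"
    and \<sigma>: "\<And>n. \<sigma> n \<in> \<Omega>"
    and lim: "limitin (quotient_function_topology \<Omega>) (metric_embedding A \<Omega> \<circ> \<sigma>) \<xi> F"
  shows "((\<lambda>n. kobayashi A \<Omega> z (\<sigma> n) - kobayashi A \<Omega> p (\<sigma> n)) \<longlongrightarrow> horofunction p \<xi> z) F"
proof -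
  interpret Metric_space \<Omega> "kobayashi A \<Omega>" by (rule met)
  have "\<xi> \<in> cont_funs \<Omega> // mod_constants \<Omega>" using limitin_topspace[OF lim] by simp
  then obtain h where h: "h \<in> cont_funs \<Omega>" "\<xi> = const_class \<Omega> h"
    unfolding const_class_def by (rule quotientE)
  have "((\<lambda>n. restrict (kobayashi A \<Omega> (\<sigma> n)) \<Omega> z - restrict (kobayashi A \<Omega> (\<sigma> n)) \<Omega> p) \<longlongrightarrow> h z - h p) F"
    using lim unfolding h(2) metric_embedding_def o_def
    by (rule limitin_const_class_pointwise[OF kobayashi_cont_funs[OF man op met \<sigma>] h(1) z p])
  then show ?thesis
    using p z by (simp add: h(2) horofunction_const_class[OF h(1) p z] commute[of _ "\<sigma> _"])
qed

section \<open>Horospheres and horoballs\<close>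

theorem lemma4p1:
  fixes A :: "('a::{t2_space, second_countable_topology}, 'n::finite) chart set"
    and \<Omega> :: "'a set" and K :: "nat \<Rightarrow> 'a set"
    and p :: 'a and R :: real and x :: "'a end_point"
  assumes "complex_manifold A"
    and "is_domain \<Omega>" and "\<Omega> \<subset> UNIV"
    and "kobayashi_hyperbolic A \<Omega>"
    and "compact_exhaustion (closure \<Omega>) K"
    and "sequentially_compact_space (end_topology \<Omega> K)"
    and "p \<in> \<Omega>" and "R > 0" and "x \<in> end_boundary \<Omega> K"
  shows "big_horosphere A \<Omega> K p x R = (\<Union>\<xi>\<in>horo_limits A \<Omega> K x. horoball \<Omega> p \<xi> R)
       \<and> small_horosphere A \<Omega> K p x R = (\<Inter>\<xi>\<in>horo_limits A \<Omega> K x. horoball \<Omega> p \<xi> R)"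
proof -
  note man = assms(1) and dom = assms(2) and ex = assms(5) and seq = assms(6) and p = assms(7)
    and x = assms(9)
  have op: "open \<Omega>" using dom by (simp add: is_domain_def)
  have met: "Metric_space \<Omega> (kobayashi A \<Omega>)" using assms(4) by (simp add: kobayashi_hyperbolic_def)
  let ?W = "within_domain \<Omega> K x" and ?H = "horo_limits A \<Omega> K x"
  define \<phi> where "\<phi> z w = kobayashi A \<Omega> z w - kobayashi A \<Omega> p w" for z w
  define c where "c = ln R / 2"
  \<comment> \<open>Values of horofunctions are cluster values of \<open>\<phi> z\<close> at \<open>x\<close>.\<close>
  have along: "\<exists>\<sigma>. filterlim \<sigma> ?W sequentially \<and> (\<forall>z\<in>\<Omega>. (\<lambda>n. \<phi> z (\<sigma> n)) \<longlonglongrightarrow> horofunction p \<xi> z)"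
    if \<xi>: "\<xi> \<in> ?H" for \<xi>
  proof -
    obtain \<sigma> where \<sigma>: "range \<sigma> \<subseteq> \<Omega>" "limitin (end_topology \<Omega> K) (Inl \<circ> \<sigma>) x sequentially"
      "limitin (quotient_function_topology \<Omega>) (metric_embedding A \<Omega> \<circ> \<sigma>) \<xi> sequentially"
      using \<xi> unfolding horo_limits_def by blast
    moreover have "\<And>n. \<sigma> n \<in> \<Omega>" using \<sigma>(1) by blast
    ultimately show ?thesis
      unfolding \<phi>_def
      using limitin_end_boundary_iff_filterlim[OF x] horofunction_as_limit[OF man op met p] by blast
  qed
  \<comment> \<open>Along any sequence tending to \<open>x\<close>, some subsequence realises a horofunction, at all \<open>z\<close> at once.\<close>
  have sublimit: "\<exists>r \<xi>. strict_mono r \<and> \<xi> \<in> ?H \<and> (\<forall>z\<in>\<Omega>. (\<lambda>n. \<phi> z (\<sigma> (r n))) \<longlonglongrightarrow> horofunction p \<xi> z)"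
    if \<sigma>: "range \<sigma> \<subseteq> \<Omega>" "limitin (end_topology \<Omega> K) (Inl \<circ> \<sigma>) x sequentially" for \<sigma> :: "nat \<Rightarrow> 'a"
  proof -
    have mem: "\<sigma> n \<in> \<Omega>" for n using \<sigma>(1) by blast
    obtain r \<xi> where r: "strict_mono r" "\<xi> \<in> metric_boundary A \<Omega>"
      "limitin (quotient_function_topology \<Omega>) (metric_embedding A \<Omega> \<circ> (\<sigma> \<circ> r)) \<xi> sequentially"
      using escaping_sequence_subconverges_to_metric_boundary[OF man dom met mem
          limitin_end_boundary_leaves_compact[OF ex x \<sigma>(2)]] .
    have "range (\<sigma> \<circ> r) \<subseteq> \<Omega>" using mem by auto
    moreover have "limitin (end_topology \<Omega> K) (Inl \<circ> (\<sigma> \<circ> r)) x sequentially"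
      using limitin_subsequence[OF r(1) \<sigma>(2)] by (simp add: o_assoc)
    ultimately have "\<xi> \<in> ?H" using r(2,3) unfolding horo_limits_def by blast
    moreover have "(\<lambda>n. \<phi> z (\<sigma> (r n))) \<longlonglongrightarrow> horofunction p \<xi> z" if "z \<in> \<Omega>" for z
      using horofunction_as_limit[OF man op met p that _ r(3)] mem by (simp add: \<phi>_def)
    ultimately show ?thesis using r(1) by blast
  qed
  have big: "Liminf ?W (\<lambda>w. ereal (\<phi> z w)) < ereal c \<longleftrightarrow> (\<exists>\<xi>\<in>?H. horofunction p \<xi> z < c)"
    if z: "z \<in> \<Omega>" for z
  proof
    assume "Liminf ?W (\<lambda>w. ereal (\<phi> z w)) < ereal c"
    then obtain b where b: "b < ereal c" "\<exists>\<^sub>F w in ?W. ereal (\<phi> z w) \<le> b"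
      unfolding not_le[symmetric] le_Liminf_iff frequently_def by auto
    obtain \<sigma> where \<sigma>: "range \<sigma> \<subseteq> \<Omega>" "\<And>n. ereal (\<phi> z (\<sigma> n)) \<le> b"
      "limitin (end_topology \<Omega> K) (Inl \<circ> \<sigma>) x sequentially"
      using frequently_within_domain_sequence[OF ex seq x, of "\<lambda>n w. ereal (\<phi> z w) \<le> b"] b(2) by blast
    obtain r \<xi> where r: "\<xi> \<in> ?H" "(\<lambda>n. \<phi> z (\<sigma> (r n))) \<longlonglongrightarrow> horofunction p \<xi> z"
      using sublimit[OF \<sigma>(1,3)] z by blast
    have "(\<lambda>n. ereal (\<phi> z (\<sigma> (r n)))) \<longlonglongrightarrow> ereal (horofunction p \<xi> z)" using r(2) by simp
    then have "ereal (horofunction p \<xi> z) \<le> b"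
      by (rule tendsto_upperbound) (use \<sigma>(2) in auto)
    then have "ereal (horofunction p \<xi> z) < ereal c" using b(1) by (rule le_less_trans)
    then show "\<exists>\<xi>\<in>?H. horofunction p \<xi> z < c" using r(1) by auto
  next
    assume "\<exists>\<xi>\<in>?H. horofunction p \<xi> z < c"
    then obtain \<xi> where \<xi>: "\<xi> \<in> ?H" "horofunction p \<xi> z < c" by blast
    then obtain b where b: "horofunction p \<xi> z < b" "b < c" using dense by blast
    obtain \<sigma> where \<sigma>: "filterlim \<sigma> ?W sequentially" "(\<lambda>n. \<phi> z (\<sigma> n)) \<longlonglongrightarrow> horofunction p \<xi> z"
      using along[OF \<xi>(1)] z by blast
    have "\<not> eventually (\<lambda>w. ereal b < ereal (\<phi> z w)) ?W"
    proof
      assume "eventually (\<lambda>w. ereal b < ereal (\<phi> z w)) ?W"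
      from eventually_compose_filterlim[OF this \<sigma>(1)]
      have "\<forall>\<^sub>F n in sequentially. b < \<phi> z (\<sigma> n)" by simp
      moreover have "\<forall>\<^sub>F n in sequentially. \<phi> z (\<sigma> n) < b" by (rule order_tendstoD(2)[OF \<sigma>(2) b(1)])
      ultimately have "\<forall>\<^sub>F n::nat in sequentially. False" by eventually_elim simp
      then show False by simp
    qed
    then have "\<not> ereal c \<le> Liminf ?W (\<lambda>w. ereal (\<phi> z w))"
      unfolding le_Liminf_iff using b(2) by (metis less_ereal.simps(1))
    then show "Liminf ?W (\<lambda>w. ereal (\<phi> z w)) < ereal c" by simp
  qed
  have small: "Limsup ?W (\<lambda>w. ereal (\<phi> z w)) < ereal c \<longleftrightarrow> (\<forall>\<xi>\<in>?H. horofunction p \<xi> z < c)"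
    if z: "z \<in> \<Omega>" for z
  proof
    assume less: "Limsup ?W (\<lambda>w. ereal (\<phi> z w)) < ereal c"
    then obtain b where b: "Limsup ?W (\<lambda>w. ereal (\<phi> z w)) < ereal b" "b < c"
      using ereal_dense2 by force
    show "\<forall>\<xi>\<in>?H. horofunction p \<xi> z < c"
    proof
      fix \<xi> assume "\<xi> \<in> ?H"
      then obtain \<sigma> where \<sigma>: "filterlim \<sigma> ?W sequentially" "(\<lambda>n. \<phi> z (\<sigma> n)) \<longlonglongrightarrow> horofunction p \<xi> z"
        using along z by blast
      have "eventually (\<lambda>w. ereal (\<phi> z w) < ereal b) ?W"
        by (rule Limsup_lessD[OF b(1)])
      from eventually_compose_filterlim[OF this \<sigma>(1)]
      have "\<forall>\<^sub>F n in sequentially. \<phi> z (\<sigma> n) \<le> b" by (rule eventually_mono) simp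
      then have "horofunction p \<xi> z \<le> b" by (rule tendsto_upperbound[OF \<sigma>(2)]) simp
      then show "horofunction p \<xi> z < c" using b(2) by simp
    qed
  next
    assume all: "\<forall>\<xi>\<in>?H. horofunction p \<xi> z < c"
    show "Limsup ?W (\<lambda>w. ereal (\<phi> z w)) < ereal c"
    proof (rule ccontr)
      assume nl: "\<not> Limsup ?W (\<lambda>w. ereal (\<phi> z w)) < ereal c"
      have "\<exists>\<^sub>F w in ?W. c - 1 / real (Suc n) < \<phi> z w" for n
      proof (rule ccontr)
        assume "\<not> (\<exists>\<^sub>F w in ?W. c - 1 / real (Suc n) < \<phi> z w)"
        then have "eventually (\<lambda>w. ereal (\<phi> z w) \<le> ereal (c - 1 / real (Suc n))) ?W"
          by (simp add: not_frequently not_less)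
        then have "Limsup ?W (\<lambda>w. ereal (\<phi> z w)) \<le> ereal (c - 1 / real (Suc n))" by (rule Limsup_bounded)
        also have "\<dots> < ereal c" by simp
        finally show False using nl by simp
      qed
      then obtain \<sigma> where \<sigma>: "range \<sigma> \<subseteq> \<Omega>" "\<And>n. c - 1 / real (Suc n) < \<phi> z (\<sigma> n)"
        "limitin (end_topology \<Omega> K) (Inl \<circ> \<sigma>) x sequentially"
        using frequently_within_domain_sequence[OF ex seq x, of "\<lambda>n w. c - 1 / real (Suc n) < \<phi> z w"] by blast
      obtain r \<xi> where r: "strict_mono r" "\<xi> \<in> ?H" "(\<lambda>n. \<phi> z (\<sigma> (r n))) \<longlonglongrightarrow> horofunction p \<xi> z"
        using sublimit[OF \<sigma>(1,3)] z by blast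
      have "(\<lambda>n. c - 1 / real (Suc n)) \<longlonglongrightarrow> c - 0"
        by (intro tendsto_intros LIMSEQ_Suc[OF lim_1_over_n])
      then have "(\<lambda>n. c - 1 / real (Suc (r n))) \<longlonglongrightarrow> c"
        using LIMSEQ_subseq_LIMSEQ[OF _ r(1)] by (force simp: o_def)
      then have "c \<le> horofunction p \<xi> z"
        by (rule tendsto_le[OF sequentially_bot r(3)])
          (rule always_eventually, rule allI, rule less_imp_le, rule \<sigma>(2))
      then show False using all r(2) by force
    qed
  qed
  \<comment> \<open>An empty intersection would be the whole manifold instead of \<open>\<Omega>\<close>.\<close>
  have nonempty: "?H \<noteq> {}"
  proof -
    have "\<exists>\<^sub>F w in ?W. True"
      using within_domain_nontrivial[OF ex seq x] by (simp add: frequently_def)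
    then obtain \<sigma> where "range \<sigma> \<subseteq> \<Omega>" "limitin (end_topology \<Omega> K) (Inl \<circ> \<sigma>) x sequentially"
      using frequently_within_domain_sequence[OF ex seq x, of "\<lambda>n w. True"] by auto
    then have "\<exists>r \<xi>. strict_mono r \<and> \<xi> \<in> ?H \<and>
        (\<forall>z\<in>\<Omega>. (\<lambda>n. \<phi> z (\<sigma> (r n))) \<longlonglongrightarrow> horofunction p \<xi> z)" by (rule sublimit)
    then show ?thesis by (elim exE conjE) (rule ex_in_conv[THEN iffD1], rule exI)
  qed
  have mem: "z \<in> horoball \<Omega> p \<xi> R \<longleftrightarrow> z \<in> \<Omega> \<and> horofunction p \<xi> z < c"
    "z \<in> big_horosphere A \<Omega> K p x R \<longleftrightarrow> z \<in> \<Omega> \<and> Liminf ?W (\<lambda>w. ereal (\<phi> z w)) < ereal c"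
    "z \<in> small_horosphere A \<Omega> K p x R \<longleftrightarrow> z \<in> \<Omega> \<and> Limsup ?W (\<lambda>w. ereal (\<phi> z w)) < ereal c" for z \<xi>
    by (simp_all only: horoball_def big_horosphere_def small_horosphere_def \<phi>_def c_def mem_Collect_eq)
  show ?thesis
  proof (intro conjI set_eqI)
    fix z
    show "z \<in> big_horosphere A \<Omega> K p x R \<longleftrightarrow> z \<in> (\<Union>\<xi>\<in>?H. horoball \<Omega> p \<xi> R)"
      unfolding UN_iff mem using big[of z] by (cases "z \<in> \<Omega>") simp_all
    show "z \<in> small_horosphere A \<Omega> K p x R \<longleftrightarrow> z \<in> (\<Inter>\<xi>\<in>?H. horoball \<Omega> p \<xi> R)"
      unfolding INT_iff mem using small[of z] nonempty by (cases "z \<in> \<Omega>") auto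
  qed
qed

end
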